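(* There is an absolute constant $C$ such that the following holds. Let $(\xi_i)_{i\in\mathbb{Z}}$ be a stationary reversible Markov chain with values in a measurable space $(S,\mathcal{S})$, with invariant distribution $\pi$ and transition operator $Q$. Let $f$ be a measurable function on $S$ with values in a separable Hilbert space (with norm $|\cdot|$) such that $E_\pi|f|^2<\infty$. Let $(a_j)_{j\ge1}$ be real constants and define, for $k\ge1$, $$s_k^e=\sum_{i=1}^ka_{2i},\quad s_k^o=\sum_{i=1}^ka_{2i-1},\quad s_0^e=s_0^o=0,\quad s_k^{e*}=\max_{1\le j\le k}|s_j^e|,\quad s_k^{o*}=\max_{1\le j\le k}|s_j^o|,$$ $$b_k^e=\max\big(k^{-1}(s_{4k}^{e*})^2,\,(s_k^e)^2-(s_{k-1}^e)^2\big),\quad b_k^o=\max\big(k^{-1}(s_{4k}^{o*})^2,\,(s_k^o)^2-(s_{k-1}^o)^2\big),\quad b_k^*=\max(b_k^e,b_k^o).$$ Then for all $n\ge1$ $$E_\pi\max_{1\le k\le2n}\Big|\sum_{j=1}^ka_jQ^jf\Big|^2\le C\sum_{j=1}^nb_j^*\,E_\pi|Q^jf|^2 .$$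
   Context: The chain has stationary transition probabilities $Q(x,A)$ and marginal distribution $\pi$ on $\mathcal{S}$. Reversible means that $(\xi_i,\xi_{i+1})$ and $(\xi_{i+1},\xi_i)$ have the same distribution. The operator $Q$ acts on $\pi$-integrable (Hilbert space valued) functions by $Qf(x)=\int_Sf(y)\,Q(x,dy)$, so that $Q^nf(\xi_0)=E(f(\xi_n)\mid\xi_0)$. $E_\pi$ denotes integration with respect to $\pi$. *)

theory Defs
  imports "HOL-Probability.Probability"
begin

definition chain_past :: "'w measure \<Rightarrow> 'a measure \<Rightarrow> (int \<Rightarrow> 'w \<Rightarrow> 'a) \<Rightarrow> int \<Rightarrow> 'w measure" where
  "chain_past P S \<xi> i =
     sigma (space P) (\<Union>j\<in>{..i}. {\<xi> j -` A \<inter> space P | A. A \<in> sets S})"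

text \<open>
  The measurable state space is \<open>S\<close> (only \<open>space S\<close> and \<open>sets S\<close> matter), the transition
  probabilities \<open>Q(x, A)\<close> are \<open>measure (K x) A\<close>, and \<open>\<pi>\<close> is the common law of all \<open>\<xi> i\<close>.
\<close>

locale stationary_reversible_markov_chain = prob_space P
  for P :: "'w measure" +
  fixes S :: "'a measure"
    and K :: "'a \<Rightarrow> 'a measure"
    and \<pi> :: "'a measure"
    and \<xi> :: "int \<Rightarrow> 'w \<Rightarrow> 'a"
  assumes kernel: "K \<in> measurable S (prob_algebra S)"
    and chain_measurable: "\<And>i. \<xi> i \<in> measurable P S"
    and marginal: "\<And>i. distr P S (\<xi> i) = \<pi>"
    and markov: "\<And>i A. A \<in> sets S \<Longrightarrow>
      AE \<omega> in P. real_cond_exp P (chain_past P S \<xi> i)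
                    (\<lambda>\<omega>'. indicator A (\<xi> (i + 1) \<omega>')) \<omega>
               = measure (K (\<xi> i \<omega>)) A"
    and reversible: "\<And>i.
      distr P (S \<Otimes>\<^sub>M S) (\<lambda>\<omega>. (\<xi> i \<omega>, \<xi> (i + 1) \<omega>)) =
      distr P (S \<Otimes>\<^sub>M S) (\<lambda>\<omega>. (\<xi> (i + 1) \<omega>, \<xi> i \<omega>))"

text \<open>
  For \<open>\<pi>\<close>-integrable \<open>f\<close> the Bochner integral below exists for \<open>\<pi>\<close>-almost every \<open>x\<close>; it takes
  the default value \<open>0\<close> on the exceptional null set. By invariance of \<open>\<pi>\<close> this choice does not
  affect the iterates up to \<open>\<pi>\<close>-null sets.
\<close>

definition transition_op ::
    "('a \<Rightarrow> 'a measure) \<Rightarrow> ('a \<Rightarrow> 'h::{banach, second_countable_topology}) \<Rightarrow> 'a \<Rightarrow> 'h" where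
  "transition_op K f = (\<lambda>x. \<integral>y. f y \<partial>K x)"

definition s_even :: "(nat \<Rightarrow> real) \<Rightarrow> nat \<Rightarrow> real" where
  "s_even a k = (\<Sum>i=1..k. a (2 * i))"

definition s_odd :: "(nat \<Rightarrow> real) \<Rightarrow> nat \<Rightarrow> real" where
  "s_odd a k = (\<Sum>i=1..k. a (2 * i - 1))"

text \<open>Used only for \<open>k \<ge> 1\<close>.\<close>

definition s_max :: "(nat \<Rightarrow> real) \<Rightarrow> nat \<Rightarrow> real" where
  "s_max s k = (MAX j\<in>{1..k}. \<bar>s j\<bar>)"

definition b_coeff :: "(nat \<Rightarrow> real) \<Rightarrow> nat \<Rightarrow> real" where
  "b_coeff s k = max ((s_max s (4 * k))\<^sup>2 / real k) ((s k)\<^sup>2 - (s (k - 1))\<^sup>2)"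

definition b_star :: "(nat \<Rightarrow> real) \<Rightarrow> nat \<Rightarrow> real" where
  "b_star a k = max (b_coeff (s_even a) k) (b_coeff (s_odd a) k)"

text \<open>
  Type variables are quantified outside every formula, so a bare \<open>\<exists>C\<close> would allow \<open>C\<close> to
  depend on the types carrying the probability space, the state space and the Hilbert space.
  Bounding \<open>C\<close> by one fixed real number makes it an absolute constant. The number itself has no
  significance and is not optimal.
\<close>

definition absolute_bound :: real where
  "absolute_bound = 1000"

end

theory Submission
  imports Defs
begin

text \<open>
  The variables \<open>M\<^sub>i = (Q\<^sup>i f)(\<xi>\<^bsub>1-i\<^esub>)\<close> form a square integrable martingale as time
  runs forward, that is, as \<open>i\<close> decreases; by reversibility \<open>Q\<^bsup>2i\<^esup> f (\<xi>\<^sub>1)\<close> and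
  \<open>Q\<^bsup>2i-1\<^esup> f (\<xi>\<^sub>0)\<close> are the conditional expectations of \<open>M\<^sub>i\<close> given \<open>\<xi>\<^sub>1\<close>
  and given \<open>\<xi>\<^sub>0\<close>. So both the even and the odd part of the sum are dominated by
  \<open>max\<^sub>k |\<Sum>\<^bsub>i\<le>k\<^esub> c\<^sub>i M\<^sub>i|\<close>. Summation by parts turns the inner sum into \<open>s\<^sub>k M\<^sub>k\<close> plus a
  martingale transform. Doob's inequality bounds the transform by
  \<open>\<Sum>\<^sub>i s\<^sub>i\<^sup>2 (E|M\<^sub>i|\<^sup>2 - E|M\<^bsub>i+1\<^esub>|\<^sup>2)\<close>, which is summed by parts back to the increments of
  \<open>s\<^sub>i\<^sup>2\<close>. The remaining term \<open>s\<^sub>k\<^sup>2 |M\<^sub>k|\<^sup>2\<close> is averaged over the indices \<open>j\<close> between \<open>k/2\<close>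
  and \<open>k\<close>, where \<open>|s\<^sub>k|\<close> is at most \<open>s\<^sup>*\<close> at \<open>4j\<close> and \<open>|M\<^sub>k|\<close> is at most the maximum of
  \<open>|M\<^sub>i|\<close> over \<open>i \<ge> j\<close>, to which Doob's inequality applies again.
\<close>

section \<open>Square integrable functions with values in a Hilbert space\<close>

text \<open>Measurability is a separate conjunct because integrability of the squared norm does not
  imply it.\<close>

definition square_integrable ::
    "'a measure \<Rightarrow> ('a \<Rightarrow> 'h::{real_inner, banach, second_countable_topology}) \<Rightarrow> bool" where
  "square_integrable M f \<longleftrightarrow> f \<in> borel_measurable M \<and> integrable M (\<lambda>x. (norm (f x))\<^sup>2)"

lemma square_integrable_measurable[measurable_dest]:
  "square_integrable M f \<Longrightarrow> f \<in> borel_measurable M"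
  by (simp add: square_integrable_def)

lemma square_integrable_bound:
  assumes "integrable M g" "f \<in> borel_measurable M"
    and "\<And>x. x \<in> space M \<Longrightarrow> (norm (f x))\<^sup>2 \<le> g x"
  shows "square_integrable M f"
  unfolding square_integrable_def
proof (intro conjI)
  show "integrable M (\<lambda>x. (norm (f x))\<^sup>2)"
    using assms by (intro Bochner_Integration.integrable_bound[OF assms(1)])
      (auto intro!: AE_I2 intro: order_trans[OF _ abs_ge_self])
qed (rule assms)

lemma norm_add_sq_le: "(norm (x + y :: 'h::real_normed_vector))\<^sup>2 \<le> 2 * (norm x)\<^sup>2 + 2 * (norm y)\<^sup>2"
proof -
  have "(norm (x + y))\<^sup>2 \<le> (norm x + norm y)\<^sup>2"
    by (intro power_mono norm_triangle_ineq) simp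
  also have "\<dots> \<le> 2 * (norm x)\<^sup>2 + 2 * (norm y)\<^sup>2"
    using sum_squares_bound[of "norm x" "norm y"] by (simp add: power2_sum)
  finally show ?thesis .
qed

lemma norm_add_scaleR_sq:
  "(norm (x + c *\<^sub>R y))\<^sup>2 = (norm x)\<^sup>2 + 2 * c * inner x y + c\<^sup>2 * (norm y)\<^sup>2"
  unfolding power2_norm_eq_inner
  by (simp add: inner_add_left inner_add_right inner_commute power2_eq_square algebra_simps)

lemma norm_diff_sq_le: "(norm (x - y :: 'h::real_normed_vector))\<^sup>2 \<le> 2 * (norm x)\<^sup>2 + 2 * (norm y)\<^sup>2"
  using norm_add_sq_le[of x "- y"] by simp

lemma square_integrable_add[intro]:
  assumes "square_integrable M f" "square_integrable M g"
  shows "square_integrable M (\<lambda>x. f x + g x)"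
  using assms norm_add_sq_le
  by (intro square_integrable_bound[where g = "\<lambda>x. 2 * (norm (f x))\<^sup>2 + 2 * (norm (g x))\<^sup>2"])
     (auto simp: square_integrable_def)

lemma square_integrable_scaleR[intro]:
  "square_integrable M f \<Longrightarrow> square_integrable M (\<lambda>x. c *\<^sub>R f x)"
  by (auto simp: square_integrable_def power_mult_distrib)

lemma square_integrable_diff[intro]:
  assumes "square_integrable M f" "square_integrable M g"
  shows "square_integrable M (\<lambda>x. f x - g x)"
  using square_integrable_add[OF assms(1) square_integrable_scaleR[OF assms(2), of "-1"]] by simp

lemma square_integrable_sum[intro]:
  "(\<And>i. i \<in> I \<Longrightarrow> square_integrable M (f i)) \<Longrightarrow> square_integrable M (\<lambda>x. \<Sum>i\<in>I. f i x)"
proof (induction I rule: infinite_finite_induct)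
  case (insert i I)
  then show ?case using square_integrable_add[of M "f i" "\<lambda>x. \<Sum>i\<in>I. f i x"] by simp
qed (auto simp: square_integrable_def)

lemma square_integrable_indicator:
  assumes "A \<in> sets M" "square_integrable M f"
  shows "square_integrable M (\<lambda>x. indicator A x *\<^sub>R f x)"
  using assms by (intro square_integrable_bound[of M "\<lambda>x. (norm (f x))\<^sup>2"])
    (auto simp: square_integrable_def indicator_def)

lemma abs_inner_le_sq: "\<bar>inner x y\<bar> \<le> ((norm x)\<^sup>2 + (norm y)\<^sup>2) / 2"
  using Cauchy_Schwarz_ineq2[of x y] sum_squares_bound[of "norm x" "norm y"]
  by (simp add: field_simps)

lemma square_integrable_inner[intro]:
  assumes "square_integrable M f" "square_integrable M g"
  shows "integrable M (\<lambda>x. inner (f x) (g x))"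
proof (rule Bochner_Integration.integrable_bound)
  show "integrable M (\<lambda>x. ((norm (f x))\<^sup>2 + (norm (g x))\<^sup>2) / 2)"
    using assms by (simp add: square_integrable_def)
qed (use assms abs_inner_le_sq in \<open>auto simp: square_integrable_def\<close>)

lemma integral_inner_diff:
  assumes "square_integrable M f" "square_integrable M g" "square_integrable M h"
  shows "(\<integral>x. inner (f x) (g x - h x) \<partial>M) = (\<integral>x. inner (f x) (g x) \<partial>M) - (\<integral>x. inner (f x) (h x) \<partial>M)"
  using assms by (simp add: inner_diff_right square_integrable_inner)

lemma integral_inner_sum:
  assumes "square_integrable M f" "\<And>i. i \<in> I \<Longrightarrow> square_integrable M (g i)"
  shows "(\<integral>x. inner (f x) (\<Sum>i\<in>I. c i *\<^sub>R g i x) \<partial>M) = (\<Sum>i\<in>I. c i * (\<integral>x. inner (f x) (g i x) \<partial>M))"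
  using assms by (simp add: inner_sum_right Bochner_Integration.integral_sum square_integrable_inner)

section \<open>Finite maxima of real functions\<close>

lemma Max_sq:
  fixes f :: "'i \<Rightarrow> real"
  assumes "finite I" "I \<noteq> {}" "\<And>i. i \<in> I \<Longrightarrow> 0 \<le> f i"
  shows "(MAX i\<in>I. f i)\<^sup>2 = (MAX i\<in>I. (f i)\<^sup>2)"
proof (rule antisym)
  have "(MAX i\<in>I. f i) \<in> f ` I"
    using assms by (intro Max_in) auto
  then obtain j where "j \<in> I" "(MAX i\<in>I. f i) = f j"
    by (rule imageE)
  then show "(MAX i\<in>I. f i)\<^sup>2 \<le> (MAX i\<in>I. (f i)\<^sup>2)" using assms by auto
  show "(MAX i\<in>I. (f i)\<^sup>2) \<le> (MAX i\<in>I. f i)\<^sup>2"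
    using assms by (auto intro!: power_mono)
qed

lemma Max_image_nonneg:
  fixes f :: "'i \<Rightarrow> real"
  assumes "finite I" "I \<noteq> {}" "\<And>i. i \<in> I \<Longrightarrow> 0 \<le> f i"
  shows "0 \<le> (MAX i\<in>I. f i)"
  using assms by (subst Max_ge_iff) auto

lemma integrable_Max:
  fixes f :: "'i \<Rightarrow> 'a \<Rightarrow> real"
  assumes "finite I" "I \<noteq> {}" "\<And>i. i \<in> I \<Longrightarrow> integrable M (f i)"
  shows "integrable M (\<lambda>x. MAX i\<in>I. f i x)"
  using assms
proof (induction I rule: finite_ne_induct)
  case (insert i I)
  then have "integrable M (\<lambda>x. max (f i x) (MAX i\<in>I. f i x))"
    by (intro Bochner_Integration.integrable_max) auto
  then show ?case using insert by simp
qed simp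

section \<open>Doob's inequality and weighted sums along a martingale\<close>

text \<open>
  Along a martingale the sum on the right has integral zero, so Doob's inequality follows without
  conditional expectations of Hilbert space valued functions.
\<close>

lemma pathwise_doob:
  fixes x :: "nat \<Rightarrow> 'h::real_inner"
  defines "y \<equiv> \<lambda>m. MAX j\<in>{..m}. norm (x j)"
  shows "(y m)\<^sup>2 \<le> 4 * (norm (x m))\<^sup>2 - 4 * (\<Sum>j<m. inner ((y j * inverse (norm (x j))) *\<^sub>R x j) (x (Suc j) - x j))"
proof -
  have y0: "0 \<le> y j" for j
    unfolding y_def by (rule Max_image_nonneg) auto
  \<comment> \<open>The product \<open>norm (x m) * y m\<close> makes the induction close. The
    square \<open>(2 * norm (x m) - y m)\<^sup>2\<close> then trades
    \<open>4 * norm (x m) * y m\<close> for \<open>4 * (norm (x m))\<^sup>2 + (y m)\<^sup>2\<close>,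
    which uses up one of the two copies of \<open>(y m)\<^sup>2\<close>.\<close>
  have "2 * (y m)\<^sup>2 - 4 * norm (x m) * y m
    \<le> - 4 * (\<Sum>j<m. inner ((y j * inverse (norm (x j))) *\<^sub>R x j) (x (Suc j) - x j))"
  proof (induction m)
    case 0
    show ?case by (simp add: y_def power2_eq_square)
  next
    case (Suc m)
    \<comment> \<open>Since \<open>inverse 0 = 0\<close>, \<open>?u\<close> is a unit vector or
      zero; in both cases its norm is at most 1 and
      \<open>inner ?u (x m) = norm (x m)\<close>.\<close>
    let ?u = "inverse (norm (x m)) *\<^sub>R x m"
    have "inner ?u (x (Suc m)) \<le> norm ?u * norm (x (Suc m))"
      by (rule norm_cauchy_schwarz)
    also have "\<dots> \<le> norm (x (Suc m))"
      by (cases "x m = 0") auto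
    finally have "inner ?u (x (Suc m) - x m) \<le> norm (x (Suc m)) - norm (x m)"
      by (cases "x m = 0")
         (auto simp: inner_diff_right power2_norm_eq_inner[symmetric] power2_eq_square field_simps)
    then have "y m * inner ?u (x (Suc m) - x m) \<le> y m * (norm (x (Suc m)) - norm (x m))"
      by (rule mult_left_mono) (rule y0)
    then have 1: "inner ((y m * inverse (norm (x m))) *\<^sub>R x m) (x (Suc m) - x m)
        \<le> y m * (norm (x (Suc m)) - norm (x m))"
      by simp
    have y': "y (Suc m) = max (norm (x (Suc m))) (y m)"
      unfolding y_def by (simp add: atMost_Suc)
    \<comment> \<open>If the maximum grows, its new value is \<open>norm (x (Suc m))\<close> and the
      right side exceeds the left by \<open>2 * (y (Suc m) - y m)\<^sup>2\<close>; otherwise both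
      sides vanish.\<close>
    have "2 * (y (Suc m))\<^sup>2 - 2 * (y m)\<^sup>2 \<le> 4 * norm (x (Suc m)) * (y (Suc m) - y m)"
    proof (cases "y m \<le> norm (x (Suc m))")
      case True
      then have "y (Suc m) = norm (x (Suc m))" using y' by simp
      then have "4 * norm (x (Suc m)) * (y (Suc m) - y m) - (2 * (y (Suc m))\<^sup>2 - 2 * (y m)\<^sup>2)
        = 2 * (y (Suc m) - y m)\<^sup>2"
        by (simp add: power2_eq_square algebra_simps)
      then show ?thesis by (smt (verit) zero_le_power2)
    qed (use y' in simp)
    then show ?case using Suc 1 by (simp add: algebra_simps)
  qed
  moreover have "0 \<le> (2 * norm (x m) - y m)\<^sup>2" by simp
  ultimately show ?thesis by (simp add: power2_eq_square algebra_simps)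
qed

text \<open>The martingale property takes a weak form: the next increment is orthogonal to every
  square integrable function known at time \<open>j\<close>. Doob's inequality and Pythagoras apply
  it directly, and the Markov property supplies it.\<close>

locale L2_martingale =
  fixes M :: "'w measure" and G :: "nat \<Rightarrow> 'w measure"
    and X :: "nat \<Rightarrow> 'w \<Rightarrow> 'h::{real_inner, banach, second_countable_topology}"
  assumes subalg: "\<And>j. subalgebra M (G j)"
    and filtration: "\<And>i j. i \<le> j \<Longrightarrow> subalgebra (G j) (G i)"
    and adapted: "\<And>j. X j \<in> borel_measurable (G j)"
    and sq_int: "\<And>j. square_integrable M (X j)"
    and orth: "\<And>j h. h \<in> borel_measurable (G j) \<Longrightarrow> square_integrable M h \<Longrightarrow>
      (\<integral>x. inner (h x) (X (Suc j) x - X j x) \<partial>M) = 0"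
begin

lemma adapted_mono: "i \<le> j \<Longrightarrow> X i \<in> borel_measurable (G j)"
  using measurable_from_subalg[OF filtration adapted] .

lemma norm_sq_integrable: "integrable M (\<lambda>x. (norm (X j x))\<^sup>2)"
  using sq_int by (simp add: square_integrable_def)

lemma Max_norm_sq_integrable: "integrable M (\<lambda>x. MAX j\<in>{..m}. (norm (X j x))\<^sup>2)"
  by (intro integrable_Max norm_sq_integrable) auto

text \<open>\<open>pathwise_doob\<close> is integrated. Its coefficient of the \<open>j\<close>-th
  increment is \<open>G j\<close>-measurable and bounded in norm by the running maximum, hence
  square integrable, so \<open>orth\<close> removes the sum.\<close>

lemma doob: "(\<integral>x. (MAX j\<in>{..m}. (norm (X j x))\<^sup>2) \<partial>M) \<le> 4 * (\<integral>x. (norm (X m x))\<^sup>2 \<partial>M)"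
proof -
  define y where "y j x = (MAX i\<in>{..j}. norm (X i x))" for j x
  define h where "h j x = (y j x * inverse (norm (X j x))) *\<^sub>R X j x" for j x
  have y_sq: "(y j x)\<^sup>2 = (MAX i\<in>{..j}. (norm (X i x))\<^sup>2)" for j x
    unfolding y_def by (rule Max_sq) auto
  have h_meas: "h j \<in> borel_measurable (G j)" for j
  proof -
    have "y j \<in> borel_measurable (G j)"
      unfolding y_def by (intro borel_measurable_Max measurable_compose[OF adapted_mono borel_measurable_norm]) auto
    then show ?thesis
      unfolding h_def using adapted[of j]
      by (intro borel_measurable_scaleR borel_measurable_times borel_measurable_inverse
            measurable_compose[OF adapted borel_measurable_norm])
  qed
  have h_sq: "square_integrable M (h j)" for j
  proof (rule square_integrable_bound[OF Max_norm_sq_integrable[of j]])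
    show "h j \<in> borel_measurable M"
      by (rule measurable_from_subalg[OF subalg h_meas])
    fix x
    have "(norm (h j x))\<^sup>2 \<le> (y j x)\<^sup>2"
      by (cases "X j x = 0") (auto simp: h_def abs_mult mult.assoc)
    then show "(norm (h j x))\<^sup>2 \<le> (MAX i\<in>{..j}. (norm (X i x))\<^sup>2)" by (simp add: y_sq)
  qed
  have int: "integrable M (\<lambda>x. inner (h j x) (X (Suc j) x - X j x))" for j
    by (intro square_integrable_inner h_sq square_integrable_diff sq_int)
  have "(\<integral>x. (MAX j\<in>{..m}. (norm (X j x))\<^sup>2) \<partial>M)
    \<le> (\<integral>x. 4 * (norm (X m x))\<^sup>2 - 4 * (\<Sum>j<m. inner (h j x) (X (Suc j) x - X j x)) \<partial>M)"
  proof (rule integral_mono)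
    fix x
    show "(MAX j\<in>{..m}. (norm (X j x))\<^sup>2)
      \<le> 4 * (norm (X m x))\<^sup>2 - 4 * (\<Sum>j<m. inner (h j x) (X (Suc j) x - X j x))"
      using pathwise_doob[of "\<lambda>j. X j x" m] unfolding h_def y_def
      by (subst (asm) Max_sq) auto
  qed (simp_all add: Max_norm_sq_integrable norm_sq_integrable int)
  also have "\<dots> = 4 * (\<integral>x. (norm (X m x))\<^sup>2 \<partial>M)
      - 4 * (\<Sum>j<m. \<integral>x. inner (h j x) (X (Suc j) x - X j x) \<partial>M)"
    using int norm_sq_integrable by simp
  also have "\<dots> = 4 * (\<integral>x. (norm (X m x))\<^sup>2 \<partial>M)"
    using orth[OF h_meas h_sq] by simp
  finally show ?thesis .
qed

definition transform :: "(nat \<Rightarrow> real) \<Rightarrow> nat \<Rightarrow> 'w \<Rightarrow> 'h" where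
  "transform d j x = (\<Sum>l<j. d l *\<^sub>R (X (Suc l) x - X l x))"

lemma transform_Suc: "transform d (Suc j) x = transform d j x + d j *\<^sub>R (X (Suc j) x - X j x)"
  by (simp add: transform_def)

lemma transform_martingale: "L2_martingale M G (transform d)"
proof
  fix j
  show "transform d j \<in> borel_measurable (G j)"
    unfolding transform_def
    by (intro borel_measurable_sum borel_measurable_scaleR borel_measurable_const
          borel_measurable_diff adapted_mono) auto
  show "square_integrable M (transform d j)"
    unfolding transform_def
    by (intro square_integrable_sum square_integrable_scaleR square_integrable_diff sq_int)
  fix h :: "'w \<Rightarrow> 'h"
  assume "h \<in> borel_measurable (G j)" "square_integrable M h"
  then show "(\<integral>x. inner (h x) (transform d (Suc j) x - transform d j x) \<partial>M) = 0"
    using orth[of h j] by (simp add: transform_Suc)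
qed (auto intro: subalg filtration)

text \<open>Pythagoras: the cross term vanishes by \<open>orth\<close>. The choice
  \<open>h = X j\<close> gives the second moment of an increment, \<open>h = transform d j\<close>
  that of a transform.\<close>

lemma norm_sq_add_increment:
  assumes h: "h \<in> borel_measurable (G j)" "square_integrable M h"
  shows "(\<integral>x. (norm (h x + c *\<^sub>R (X (Suc j) x - X j x)))\<^sup>2 \<partial>M)
    = (\<integral>x. (norm (h x))\<^sup>2 \<partial>M) + c\<^sup>2 * (\<integral>x. (norm (X (Suc j) x - X j x))\<^sup>2 \<partial>M)"
proof -
  have D: "square_integrable M (\<lambda>x. X (Suc j) x - X j x)"
    by (intro square_integrable_diff sq_int)
  have "(\<integral>x. (norm (h x + c *\<^sub>R (X (Suc j) x - X j x)))\<^sup>2 \<partial>M)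
    = (\<integral>x. (norm (h x))\<^sup>2 + 2 * c * inner (h x) (X (Suc j) x - X j x)
        + c\<^sup>2 * (norm (X (Suc j) x - X j x))\<^sup>2 \<partial>M)"
    by (simp add: norm_add_scaleR_sq)
  also have "\<dots> = (\<integral>x. (norm (h x))\<^sup>2 \<partial>M) + 2 * c * (\<integral>x. inner (h x) (X (Suc j) x - X j x) \<partial>M)
      + c\<^sup>2 * (\<integral>x. (norm (X (Suc j) x - X j x))\<^sup>2 \<partial>M)"
    using square_integrable_inner[OF h(2) D] h(2) D by (simp add: square_integrable_def)
  finally show ?thesis using orth[OF h] by simp
qed

lemma norm_sq_increment:
  "(\<integral>x. (norm (X (Suc j) x - X j x))\<^sup>2 \<partial>M) = (\<integral>x. (norm (X (Suc j) x))\<^sup>2 \<partial>M) - (\<integral>x. (norm (X j x))\<^sup>2 \<partial>M)"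
  using norm_sq_add_increment[OF adapted sq_int, of j 1] by simp

text \<open>Orthogonality of increments, as in the Ito isometry; each squared increment appears as a
  difference of second moments, ready for summation by parts.\<close>

lemma norm_sq_transform:
  "(\<integral>x. (norm (transform d m x))\<^sup>2 \<partial>M)
    = (\<Sum>l<m. (d l)\<^sup>2 * ((\<integral>x. (norm (X (Suc l) x))\<^sup>2 \<partial>M) - (\<integral>x. (norm (X l x))\<^sup>2 \<partial>M)))"
proof (induction m)
  case 0
  show ?case by (simp add: transform_def)
next
  case (Suc m)
  interpret T: L2_martingale M G "transform d" by (rule transform_martingale)
  show ?case
    using Suc norm_sq_add_increment[OF T.adapted T.sq_int, of m "d m"]
    by (simp add: transform_Suc norm_sq_increment)
qed

text \<open>The sum runs against the time of the martingale: larger \<open>i\<close> means earlier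
  \<open>X (n - i)\<close>. Of the two terms in \<open>b_coeff\<close>, the first controls the end
  value \<open>s k *\<^sub>R X (n - k)\<close> and the second the martingale transform.\<close>

lemma max_weighted_sum:
  fixes c :: "nat \<Rightarrow> real"
  defines "s \<equiv> \<lambda>k. \<Sum>i=1..k. c i"
  assumes n: "1 \<le> n"
  shows "(\<integral>x. (MAX k\<in>{1..n}. (norm (\<Sum>i=1..k. c i *\<^sub>R X (n - i) x))\<^sup>2) \<partial>M)
    \<le> 36 * (\<Sum>j=1..n. b_coeff s j * (\<integral>x. (norm (X (n - j) x))\<^sup>2 \<partial>M))"
proof -
  define Z where "Z k x = (\<Sum>i=1..k. c i *\<^sub>R X (n - i) x)" for k x
  define T where "T = transform (\<lambda>l. s (n - 1 - l))"
  \<comment> \<open>Indices \<open>l \<le> n - j\<close> correspond to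
    \<open>i = n - l \<ge> j\<close>, so \<open>Y j\<close> is the maximum of the squared norms of
    \<open>X (n - i)\<close> over \<open>i\<close> from \<open>j\<close> to
    \<open>n\<close>.\<close>
  define Y where "Y j x = (MAX l\<in>{..n - j}. (norm (X l x))\<^sup>2)" for j x
  define q where "q j = (s_max s (4 * j))\<^sup>2 / real j" for j
  define R where "R x = (\<Sum>j=1..n. q j * Y j x)" for x
  define p where "p j = (\<integral>x. (norm (X (n - j) x))\<^sup>2 \<partial>M)" for j
  define V where "V = (\<integral>x. (norm (T (n - 1) x))\<^sup>2 \<partial>M)"
  interpret T: L2_martingale M G T unfolding T_def by (rule transform_martingale)
  have p0: "0 \<le> p j" for j by (simp add: p_def)
  have q0: "0 \<le> q j" for j by (simp add: q_def)
  \<comment> \<open>Summation by parts. The weight of \<open>T\<close> at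
    \<open>l = n - 1 - i\<close> is \<open>s i\<close>, so \<open>T (n - 1) x - T (n - k) x\<close>
    collects \<open>s i\<close> times the increment from \<open>X (n - i - 1)\<close> to
    \<open>X (n - i)\<close> for \<open>1 \<le> i < k\<close>.\<close>
  have decomp: "Z k x = s k *\<^sub>R X (n - k) x + (T (n - 1) x - T (n - k) x)" if "1 \<le> k" "k \<le> n" for k x
    using that
  proof (induction k rule: nat_induct_at_least)
    case base
    show ?case by (simp add: Z_def s_def)
  next
    case (Suc k)
    have *: "Suc (n - Suc k) = n - k" "n - 1 - (n - Suc k) = k" using Suc by auto
    have T_eq: "T (n - k) x = T (n - Suc k) x + s k *\<^sub>R (X (n - k) x - X (n - Suc k) x)"
      using transform_Suc[of "\<lambda>l. s (n - 1 - l)" "n - Suc k" x] unfolding T_def * .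
    have "Z (Suc k) x = Z k x + c (Suc k) *\<^sub>R X (n - Suc k) x" by (simp add: Z_def)
    also have "Z k x = s k *\<^sub>R X (n - k) x + (T (n - 1) x - T (n - k) x)" using Suc by simp
    finally show ?case unfolding T_eq by (simp add: s_def scaleR_add_left scaleR_diff_right)
  qed
  have R_bound: "(s k)\<^sup>2 * (norm (X (n - k) x))\<^sup>2 \<le> 2 * R x" if k: "1 \<le> k" "k \<le> n" for k x
  proof -
    let ?t = "(s k)\<^sup>2 * (norm (X (n - k) x))\<^sup>2"
    \<comment> \<open>The upper half of \<open>{1..k}\<close>. It has \<open>k div 2 + 1\<close>
      elements, at least half of \<open>k\<close>, and \<open>k \<le> 4 * j\<close> for each
      \<open>j\<close> in it. Averaging over it leads to the sum \<open>R\<close>, which does not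
      depend on \<open>k\<close>.\<close>
    let ?J = "{k - k div 2..k}"
    have "real k \<le> 2 * real (card ?J)" by simp
    then have "?t \<le> 2 * (real (card ?J) * (?t / real k))"
      using k mult_right_mono[of "real k" "2 * real (card ?J)" "?t / real k"]
      by (simp add: algebra_simps)
    also have "real (card ?J) * (?t / real k) = (\<Sum>j\<in>?J. ?t / real k)" by simp
    also have "\<dots> \<le> (\<Sum>j\<in>?J. q j * Y j x)"
    proof (rule sum_mono)
      fix j assume j: "j \<in> ?J"
      then have j': "1 \<le> j" "j \<le> k" "k \<le> 4 * j" using k by auto
      have "\<bar>s k\<bar> \<le> s_max s (4 * j)"
        unfolding s_max_def using j' k by (intro Max_ge) auto
      then have "(s k)\<^sup>2 \<le> (s_max s (4 * j))\<^sup>2" by (simp add: abs_le_square_iff[symmetric])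
      then have "(s k)\<^sup>2 / real k \<le> q j"
        unfolding q_def using j' by (intro frac_le) auto
      moreover have "(norm (X (n - k) x))\<^sup>2 \<le> Y j x"
        unfolding Y_def using j' by (intro Max_ge) auto
      ultimately have "(s k)\<^sup>2 / real k * (norm (X (n - k) x))\<^sup>2 \<le> q j * Y j x"
        by (intro mult_mono) (auto simp: q0)
      then show "?t / real k \<le> q j * Y j x" by simp
    qed
    also have "\<dots> \<le> R x"
      unfolding R_def
    proof (rule sum_mono2)
      show "?J \<subseteq> {1..n}" using k by auto
      fix j
      have "0 \<le> Y j x" unfolding Y_def
        by (rule Max_image_nonneg) auto
      then show "0 \<le> q j * Y j x" by (simp add: q0)
    qed simp
    finally show ?thesis by simp
  qed
  have Y_int: "integrable M (Y j)" for j
    unfolding Y_def by (rule Max_norm_sq_integrable)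
  \<comment> \<open>\<open>norm_add_sq_le\<close> applied to \<open>decomp\<close> doubles both
    parts; a second factor 2 comes from \<open>R_bound\<close> and from separating the two values of
    \<open>T\<close>.\<close>
  have bound: "(MAX k\<in>{1..n}. (norm (Z k x))\<^sup>2)
      \<le> 4 * R x + 4 * (norm (T (n - 1) x))\<^sup>2 + 4 * (MAX j\<in>{..n - 1}. (norm (T j x))\<^sup>2)" for x
  proof (rule Max.boundedI)
    fix z assume "z \<in> (\<lambda>k. (norm (Z k x))\<^sup>2) ` {1..n}"
    then obtain k where k: "1 \<le> k" "k \<le> n" and z: "z = (norm (Z k x))\<^sup>2" by auto
    have "z \<le> 2 * (norm (s k *\<^sub>R X (n - k) x))\<^sup>2 + 2 * (norm (T (n - 1) x - T (n - k) x))\<^sup>2"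
      unfolding z decomp[OF k] by (rule norm_add_sq_le)
    moreover have "(norm (s k *\<^sub>R X (n - k) x))\<^sup>2 \<le> 2 * R x"
      using R_bound[OF k] by (simp add: power_mult_distrib)
    moreover have "(norm (T (n - 1) x - T (n - k) x))\<^sup>2
      \<le> 2 * (norm (T (n - 1) x))\<^sup>2 + 2 * (norm (T (n - k) x))\<^sup>2"
      by (rule norm_diff_sq_le)
    moreover have "(norm (T (n - k) x))\<^sup>2 \<le> (MAX j\<in>{..n - 1}. (norm (T j x))\<^sup>2)"
      using k by (intro Max_ge) auto
    ultimately show "z \<le> 4 * R x + 4 * (norm (T (n - 1) x))\<^sup>2 + 4 * (MAX j\<in>{..n - 1}. (norm (T j x))\<^sup>2)"
      by linarith
  qed (use n in auto)
  have "(\<integral>x. (MAX k\<in>{1..n}. (norm (Z k x))\<^sup>2) \<partial>M)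
      \<le> (\<integral>x. 4 * R x + 4 * (norm (T (n - 1) x))\<^sup>2 + 4 * (MAX j\<in>{..n - 1}. (norm (T j x))\<^sup>2) \<partial>M)"
  proof (rule integral_mono[OF _ _ bound])
    have "square_integrable M (Z k)" for k
      unfolding Z_def by (intro square_integrable_sum square_integrable_scaleR sq_int)
    then show "integrable M (\<lambda>x. MAX k\<in>{1..n}. (norm (Z k x))\<^sup>2)"
      using n by (intro integrable_Max) (auto simp: square_integrable_def)
    show "integrable M (\<lambda>x. 4 * R x + 4 * (norm (T (n - 1) x))\<^sup>2 + 4 * (MAX j\<in>{..n - 1}. (norm (T j x))\<^sup>2))"
      unfolding R_def
      by (intro Bochner_Integration.integrable_add integrable_mult_right Bochner_Integration.integrable_sum
            Y_int T.norm_sq_integrable T.Max_norm_sq_integrable)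
  qed
  also have "\<dots> = 4 * (\<Sum>j=1..n. q j * (\<integral>x. Y j x \<partial>M)) + 4 * V
      + 4 * (\<integral>x. (MAX j\<in>{..n - 1}. (norm (T j x))\<^sup>2) \<partial>M)"
    unfolding R_def V_def using Y_int T.norm_sq_integrable T.Max_norm_sq_integrable by simp
  \<comment> \<open>Doob for \<open>X\<close> up to \<open>n - j\<close> bounds the integral of
    \<open>Y j\<close> by \<open>4 * p j\<close>, and Doob for \<open>T\<close> bounds its maximum
    by \<open>4 * V\<close>. This gives the constants 16 and 20, whose sum is 36.\<close>
  also have "\<dots> \<le> 4 * (\<Sum>j=1..n. q j * (4 * p j)) + 4 * V + 4 * (4 * V)"
    unfolding V_def p_def Y_def
    by (intro add_mono mult_left_mono sum_mono doob T.doob q0 order_refl) auto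
  also have "\<dots> = 16 * (\<Sum>j=1..n. q j * p j) + 20 * V"
    by (simp add: sum_distrib_left mult_ac)
  also have "\<dots> \<le> 16 * (\<Sum>j=1..n. b_coeff s j * p j) + 20 * (\<Sum>j=1..n. b_coeff s j * p j)"
  proof (intro add_mono mult_left_mono)
    show "(\<Sum>j=1..n. q j * p j) \<le> (\<Sum>j=1..n. b_coeff s j * p j)"
      by (intro sum_mono mult_right_mono p0) (simp add: b_coeff_def q_def)
    obtain m where m: "n = Suc m" using n by (cases n) auto
    have "V = (\<Sum>l<m. (s (m - l))\<^sup>2 * (p (m - l) - p (Suc m - l)))"
      unfolding V_def T_def norm_sq_transform p_def using m
      by (auto intro!: sum.cong simp: Suc_diff_le)
    also have "\<dots> = (\<Sum>l<m. (s (Suc (m - Suc l)))\<^sup>2 * (p (Suc (m - Suc l)) - p (Suc (Suc (m - Suc l)))))"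
      by (intro sum.cong) (auto simp: Suc_diff_Suc Suc_diff_le)
    also have "\<dots> = (\<Sum>i<m. (s (Suc i))\<^sup>2 * (p (Suc i) - p (Suc (Suc i))))"
      by (rule sum.nat_diff_reindex)
    \<comment> \<open>Summation by parts with \<open>s 0 = 0\<close> moves the differences from
      \<open>p\<close> to the squares of \<open>s\<close>. The boundary term carries a minus sign
      and is dropped next.\<close>
    also have "\<dots> = (\<Sum>j=1..Suc m. ((s j)\<^sup>2 - (s (j - 1))\<^sup>2) * p j) - (s (Suc m))\<^sup>2 * p (Suc m)"
      by (induction m) (simp_all add: s_def algebra_simps del: sum.cl_ivl_Suc, simp_all add: algebra_simps)
    also have "\<dots> \<le> (\<Sum>j=1..n. ((s j)\<^sup>2 - (s (j - 1))\<^sup>2) * p j)"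
      unfolding m using p0 by simp
    also have "\<dots> \<le> (\<Sum>j=1..n. b_coeff s j * p j)"
      by (intro sum_mono mult_right_mono p0) (simp add: b_coeff_def)
    finally show "V \<le> (\<Sum>j=1..n. b_coeff s j * p j)" .
  qed auto
  finally show ?thesis by (simp add: Z_def p_def)
qed

end

section \<open>Splitting by parity, and integration against a kernel\<close>

lemma sum_even_odd_split:
  fixes v :: "nat \<Rightarrow> 'h::real_vector"
  shows "(\<Sum>j=1..k. v j) = (\<Sum>i=1..k div 2. v (2 * i)) + (\<Sum>i=1..(k + 1) div 2. v (2 * i - 1))"
proof (induction k)
  case (Suc k)
  show ?case
  proof (cases "even k")
    case True
    then obtain m where "k = 2 * m" by (rule evenE)
    then show ?thesis using Suc by simp
  next
    case False
    then obtain m where "k = 2 * m + 1" by (rule oddE)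
    then show ?thesis using Suc by simp
  qed
qed simp

lemma b_star_nonneg: "0 \<le> b_star a k"
  by (simp add: b_star_def b_coeff_def le_max_iff_disj)

text \<open>\<open>nn_integral_bind\<close> is applied to the positive and the negative part of
  \<open>u\<close>. Both integrals are finite, hence both parts are finite under
  \<open>\<kappa> x\<close> for almost every \<open>x\<close> and can be subtracted there.\<close>

lemma integral_bind_integrable:
  fixes u :: "'b \<Rightarrow> real"
  assumes \<kappa>: "\<kappa> \<in> measurable M (subprob_algebra B)"
    and u: "u \<in> borel_measurable B" and int: "integrable (M \<bind> \<kappa>) u"
  shows "(\<integral>z. u z \<partial>(M \<bind> \<kappa>)) = (\<integral>x. (\<integral>z. u z \<partial>\<kappa> x) \<partial>M)"
proof -
  \<comment> \<open>As \<open>ennreal\<close> sends negative reals to 0, \<open>p u\<close> and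
    \<open>p (\<lambda>z. - u z)\<close> are the integrals of the positive and of the negative part
    of \<open>u\<close>.\<close>
  define p where "p v x = (\<integral>\<^sup>+z. ennreal (v z) \<partial>\<kappa> x)" for v :: "'b \<Rightarrow> real" and x
  have p_meas: "p v \<in> borel_measurable M" if "v \<in> borel_measurable B" for v
    unfolding p_def using that
    by (intro measurable_compose[OF \<kappa> nn_integral_measurable_subprob_algebra]) simp
  have p_int: "(\<integral>\<^sup>+x. p v x \<partial>M) = (\<integral>\<^sup>+z. ennreal (v z) \<partial>(M \<bind> \<kappa>))" if "v \<in> borel_measurable B" for v
    unfolding p_def using that \<kappa> by (subst nn_integral_bind[where B = B]) auto
  have fin: "(\<integral>\<^sup>+x. p v x \<partial>M) < \<infinity>" if "v = u \<or> v = (\<lambda>z. - u z)" for v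
  proof -
    have "(\<integral>\<^sup>+z. ennreal (v z) \<partial>(M \<bind> \<kappa>)) \<le> (\<integral>\<^sup>+z. norm (u z) \<partial>(M \<bind> \<kappa>))"
      using that by (intro nn_integral_mono ennreal_leI) auto
    also have "\<dots> < \<infinity>" using int by (simp add: integrable_iff_bounded)
    finally show ?thesis using p_int[of v] that u by auto
  qed
  have AE_fin: "AE x in M. p v x \<noteq> \<infinity>" if "v = u \<or> v = (\<lambda>z. - u z)" for v
    using fin[OF that] p_meas[of v] that u by (intro nn_integral_PInf_AE) auto
  have real: "(\<integral>x. enn2real (p v x) \<partial>M) = enn2real (\<integral>\<^sup>+x. p v x \<partial>M)"
    and real_int: "integrable M (\<lambda>x. enn2real (p v x))" if "v = u \<or> v = (\<lambda>z. - u z)" for v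
  proof -
    have meas: "(\<lambda>x. enn2real (p v x)) \<in> borel_measurable M"
      using p_meas[of v] that u by auto
    have eq: "(\<integral>\<^sup>+x. ennreal (enn2real (p v x)) \<partial>M) = (\<integral>\<^sup>+x. p v x \<partial>M)"
      using AE_fin[OF that] by (intro nn_integral_cong_AE) (auto simp: less_top)
    show "(\<integral>x. enn2real (p v x) \<partial>M) = enn2real (\<integral>\<^sup>+x. p v x \<partial>M)"
      using meas by (subst integral_eq_nn_integral) (auto simp: eq)
    show "integrable M (\<lambda>x. enn2real (p v x))"
      using meas fin[OF that] by (intro integrableI_nonneg) (auto simp: eq)
  qed
  have "(\<integral>x. (\<integral>z. u z \<partial>\<kappa> x) \<partial>M) = (\<integral>x. enn2real (p u x) - enn2real (p (\<lambda>z. - u z) x) \<partial>M)"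
  proof (rule integral_cong_AE)
    show "(\<lambda>x. \<integral>z. u z \<partial>\<kappa> x) \<in> borel_measurable M"
      by (rule measurable_compose[OF \<kappa> integral_measurable_subprob_algebra[OF u]])
    show "(\<lambda>x. enn2real (p u x) - enn2real (p (\<lambda>z. - u z) x)) \<in> borel_measurable M"
      using p_meas[of u] p_meas[of "\<lambda>z. - u z"] u by auto
    have "AE x in M. x \<in> space M" by simp
    then show "AE x in M. (\<integral>z. u z \<partial>\<kappa> x) = enn2real (p u x) - enn2real (p (\<lambda>z. - u z) x)"
      using AE_fin[of u, simplified] AE_fin[of "\<lambda>z. - u z", simplified]
    proof eventually_elim
      case (elim x)
      have "u \<in> borel_measurable (\<kappa> x)"
        using u subprob_measurableD(2)[OF \<kappa> elim(1)] by (simp cong: measurable_cong_sets)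
      then have "integrable (\<kappa> x) u"
        unfolding real_integrable_def using elim by (auto simp: p_def)
      then show ?case unfolding p_def by (rule real_lebesgue_integral_def)
    qed
  qed
  also have "\<dots> = enn2real (\<integral>\<^sup>+x. p u x \<partial>M) - enn2real (\<integral>\<^sup>+x. p (\<lambda>z. - u z) x \<partial>M)"
    by (simp add: real real_int)
  also have "\<dots> = (\<integral>z. u z \<partial>(M \<bind> \<kappa>))"
    using u by (simp add: p_int real_lebesgue_integral_def[OF int])
  finally show ?thesis ..
qed

section \<open>The kernel, the past, and the joint law of the past and the next state\<close>

context stationary_reversible_markov_chain
begin

lemma sets_pi[simp]: "sets \<pi> = sets S"
  using marginal[of 0] by (metis sets_distr)

lemma space_pi[simp]: "space \<pi> = space S"
  by (rule sets_eq_imp_space_eq) simp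

lemma measurable_pi: "measurable \<pi> N = measurable S N"
  by (rule measurable_cong_sets) simp_all

lemma kernel_subprob: "K \<in> measurable S (subprob_algebra S)"
  by (rule measurable_prob_algebraD[OF kernel])

lemma sets_kernel: "x \<in> space S \<Longrightarrow> sets (K x) = sets S"
  by (rule subprob_measurableD(2)[OF kernel_subprob])

lemma prob_space_kernel: "x \<in> space S \<Longrightarrow> prob_space (K x)"
  using measurable_space[OF kernel] by (simp add: space_prob_algebra)

lemma state_space: "\<omega> \<in> space P \<Longrightarrow> \<xi> i \<omega> \<in> space S"
  using measurable_space[OF chain_measurable] .

abbreviation past :: "int \<Rightarrow> 'w measure" where "past i \<equiv> chain_past P S \<xi> i"

lemma space_past[simp]: "space (past i) = space P"
  unfolding chain_past_def by (intro space_measure_of) auto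

lemma sets_past:
  "sets (past i) = sigma_sets (space P) (\<Union>j\<in>{..i}. {\<xi> j -` A \<inter> space P | A. A \<in> sets S})"
  unfolding chain_past_def by (intro sets_measure_of) auto

lemma subalgebra_past: "subalgebra P (past i)"
  unfolding subalgebra_def sets_past
  by (auto intro!: sets.sigma_sets_subset measurable_sets[OF chain_measurable])

lemma past_mono: "i \<le> j \<Longrightarrow> subalgebra (past j) (past i)"
  unfolding subalgebra_def sets_past space_past
  by (intro conjI refl sigma_sets_mono' UN_mono) simp_all

lemma chain_adapted: "j \<le> i \<Longrightarrow> \<xi> j \<in> measurable (past i) S"
proof (rule measurableI)
  fix A assume "j \<le> i" "A \<in> sets S"
  then show "\<xi> j -` A \<inter> space (past i) \<in> sets (past i)"
    unfolding sets_past space_past by (intro sigma_sets.Basic) blast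
qed (simp add: state_space)

text \<open>The Markov property integrated over a past event: the defining identity of
  \<open>real_cond_exp\<close> turns \<open>markov\<close> into a formula for joint
  probabilities.\<close>

lemma emeasure_past_next:
  assumes A: "A \<in> sets (past i)" and B: "B \<in> sets S"
  shows "emeasure P (A \<inter> (\<xi> (i + 1) -` B \<inter> space P)) = (\<integral>\<^sup>+\<omega>. indicator A \<omega> * emeasure (K (\<xi> i \<omega>)) B \<partial>P)"
proof -
  interpret sub: finite_measure_subalgebra P "past i"
    by standard (rule subalgebra_past)
  have A': "A \<in> sets P" using A subalgebra_past[of i] by (auto simp: subalgebra_def)
  have B': "\<xi> (i + 1) -` B \<inter> space P \<in> sets P"
    by (rule measurable_sets[OF chain_measurable B])
  have int: "integrable P (\<lambda>\<omega>. indicator B (\<xi> (i + 1) \<omega>) :: real)"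
    using chain_measurable B by (intro integrable_const_bound[where B = 1]) auto
  have Kmeas: "(\<lambda>\<omega>. measure (K (\<xi> i \<omega>)) B) \<in> borel_measurable P"
    using measurable_compose[OF measurable_compose[OF chain_measurable kernel_subprob]
        measurable_measure_subprob_algebra[OF B]] .
  have Kint: "integrable P (\<lambda>\<omega>. indicator A \<omega> * measure (K (\<xi> i \<omega>)) B)"
    using A' Kmeas
    by (intro integrable_const_bound[where B = 1])
       (auto simp: indicator_def prob_space.prob_le_1[OF prob_space_kernel[OF state_space]])
  have "emeasure P (A \<inter> (\<xi> (i + 1) -` B \<inter> space P)) = ennreal (\<integral>\<omega>\<in>A. indicator B (\<xi> (i + 1) \<omega>) \<partial>P)"
  proof -
    have "(\<integral>\<omega>\<in>A. indicator B (\<xi> (i + 1) \<omega>) \<partial>P)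
      = (\<integral>\<omega>. indicator (A \<inter> (\<xi> (i + 1) -` B \<inter> space P)) \<omega> \<partial>P)"
      unfolding set_lebesgue_integral_def
      by (intro Bochner_Integration.integral_cong) (auto simp: indicator_def)
    also have "\<dots> = measure P (A \<inter> (\<xi> (i + 1) -` B \<inter> space P))"
      using A' B' by simp
    finally show ?thesis by (simp add: emeasure_eq_measure)
  qed
  also have "(\<integral>\<omega>\<in>A. indicator B (\<xi> (i + 1) \<omega>) \<partial>P)
    = (\<integral>\<omega>\<in>A. real_cond_exp P (past i) (\<lambda>\<omega>'. indicator B (\<xi> (i + 1) \<omega>')) \<omega> \<partial>P)"
    by (rule sub.real_cond_exp_intA[OF int A])
  also have "\<dots> = (\<integral>\<omega>. indicator A \<omega> * measure (K (\<xi> i \<omega>)) B \<partial>P)"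
    unfolding set_lebesgue_integral_def
    using markov[OF B, of i] A' Kmeas by (intro integral_cong_AE) auto
  also have "ennreal \<dots> = (\<integral>\<^sup>+\<omega>. ennreal (indicator A \<omega> * measure (K (\<xi> i \<omega>)) B) \<partial>P)"
    using Kint by (subst nn_integral_eq_integral) auto
  also have "\<dots> = (\<integral>\<^sup>+\<omega>. indicator A \<omega> * emeasure (K (\<xi> i \<omega>)) B \<partial>P)"
  proof (rule nn_integral_cong)
    fix \<omega> assume "\<omega> \<in> space P"
    then interpret k: prob_space "K (\<xi> i \<omega>)" by (intro prob_space_kernel state_space)
    show "ennreal (indicator A \<omega> * measure (K (\<xi> i \<omega>)) B) = indicator A \<omega> * emeasure (K (\<xi> i \<omega>)) B"
      by (simp add: k.emeasure_eq_measure indicator_def)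
  qed
  finally show ?thesis .
qed

text \<open>The conditional law of \<open>(\<omega>, \<xi> (i + 1) \<omega>)\<close> given the past.
  Keeping all of \<open>\<omega>\<close>, with the sigma-algebra \<open>past i\<close>, allows tests
  against arbitrary functions of the past.\<close>

definition past_kernel :: "int \<Rightarrow> 'w \<Rightarrow> ('w \<times> 'a) measure" where
  "past_kernel i \<omega> = distr (K (\<xi> i \<omega>)) (past i \<Otimes>\<^sub>M S) (Pair \<omega>)"

lemma kernel_chain_measurable: "(\<lambda>\<omega>. K (\<xi> i \<omega>)) \<in> measurable P (subprob_algebra S)"
  by (rule measurable_compose[OF chain_measurable kernel_subprob])

lemma id_past_measurable: "(\<lambda>\<omega>. \<omega>) \<in> measurable P (past i)"
  by (rule measurable_from_subalg[OF subalgebra_past measurable_ident_sets[OF refl]])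

lemma Pair_past_measurable: "\<omega> \<in> space P \<Longrightarrow> Pair \<omega> \<in> measurable (K (\<xi> i \<omega>)) (past i \<Otimes>\<^sub>M S)"
  using sets_kernel[OF state_space, of \<omega> i] by (auto cong: measurable_cong_sets)

lemma past_kernel_measurable: "past_kernel i \<in> measurable P (subprob_algebra (past i \<Otimes>\<^sub>M S))"
proof -
  have "(\<lambda>p. (fst p, snd p)) \<in> measurable (P \<Otimes>\<^sub>M S) (past i \<Otimes>\<^sub>M S)"
    by (intro measurable_Pair measurable_compose[OF measurable_fst id_past_measurable] measurable_snd)
  then show ?thesis
    unfolding past_kernel_def[abs_def]
    by (intro measurable_distr2[OF _ kernel_chain_measurable]) (simp add: case_prod_unfold)
qed

lemma pair_next_measurable: "(\<lambda>\<omega>. (\<omega>, \<xi> (i + 1) \<omega>)) \<in> measurable P (past i \<Otimes>\<^sub>M S)"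
  by (intro measurable_Pair id_past_measurable chain_measurable)

text \<open>Both sides agree on rectangles by \<open>emeasure_past_next\<close>, and rectangles form
  an intersection stable generator of the product sigma-algebra.\<close>

lemma distr_pair_next: "distr P (past i \<Otimes>\<^sub>M S) (\<lambda>\<omega>. (\<omega>, \<xi> (i + 1) \<omega>)) = P \<bind> past_kernel i"
proof (rule measure_eqI_generator_eq[OF Int_stable_pair_measure_generator[of "past i" S]])
  let ?E = "{a \<times> b |a b. a \<in> sets (past i) \<and> b \<in> sets S}"
  let ?O = "space (past i) \<times> space S"
  show "?E \<subseteq> Pow ?O"
    using sets.space_closed[of "past i"] sets.space_closed[of S] by auto
  show "sets (distr P (past i \<Otimes>\<^sub>M S) (\<lambda>\<omega>. (\<omega>, \<xi> (i + 1) \<omega>))) = sigma_sets ?O ?E"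
    by (simp add: sets_pair_measure)
  show "sets (P \<bind> past_kernel i) = sigma_sets ?O ?E"
    using sets_bind[OF subprob_measurableD(2)[OF past_kernel_measurable[of i]] not_empty]
    by (simp add: sets_pair_measure)
  have "space P \<in> sets (past i)" using sets.top[of "past i"] by simp
  then show "range (\<lambda>_::nat. ?O) \<subseteq> ?E" by auto
  show "(\<Union>n::nat. ?O) = ?O" by auto
  show "emeasure (distr P (past i \<Otimes>\<^sub>M S) (\<lambda>\<omega>. (\<omega>, \<xi> (i + 1) \<omega>))) ?O \<noteq> \<infinity>"
    using finite_measure.emeasure_finite[OF prob_space.finite_measure[OF prob_space_distr[OF pair_next_measurable]]]
    by simp
  fix X assume "X \<in> ?E"
  then obtain A B where X: "X = A \<times> B" and A: "A \<in> sets (past i)" and B: "B \<in> sets S" by auto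
  have "emeasure (distr P (past i \<Otimes>\<^sub>M S) (\<lambda>\<omega>. (\<omega>, \<xi> (i + 1) \<omega>))) X
      = emeasure P ((\<lambda>\<omega>. (\<omega>, \<xi> (i + 1) \<omega>)) -` X \<inter> space P)"
    using A B X by (intro emeasure_distr pair_next_measurable) auto
  also have "(\<lambda>\<omega>. (\<omega>, \<xi> (i + 1) \<omega>)) -` X \<inter> space P = A \<inter> (\<xi> (i + 1) -` B \<inter> space P)"
    unfolding X by auto
  also have "emeasure P \<dots> = (\<integral>\<^sup>+\<omega>. indicator A \<omega> * emeasure (K (\<xi> i \<omega>)) B \<partial>P)"
    by (rule emeasure_past_next[OF A B])
  also have "\<dots> = (\<integral>\<^sup>+\<omega>. emeasure (past_kernel i \<omega>) X \<partial>P)"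
  proof (rule nn_integral_cong)
    fix \<omega> assume \<omega>: "\<omega> \<in> space P"
    have "emeasure (past_kernel i \<omega>) X = emeasure (K (\<xi> i \<omega>)) (Pair \<omega> -` X \<inter> space (K (\<xi> i \<omega>)))"
      unfolding past_kernel_def using A B X by (intro emeasure_distr Pair_past_measurable \<omega>) auto
    also have "Pair \<omega> -` X \<inter> space (K (\<xi> i \<omega>)) = (if \<omega> \<in> A then B else {})"
      unfolding X using sets.sets_into_space[OF B] sets_eq_imp_space_eq[OF sets_kernel[OF state_space[OF \<omega>]]]
      by auto
    finally show "indicator A \<omega> * emeasure (K (\<xi> i \<omega>)) B = emeasure (past_kernel i \<omega>) X" by simp
  qed
  also have "\<dots> = emeasure (P \<bind> past_kernel i) X"
    using A B X not_empty by (subst emeasure_bind[OF _ past_kernel_measurable]) auto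
  finally show "emeasure (distr P (past i \<Otimes>\<^sub>M S) (\<lambda>\<omega>. (\<omega>, \<xi> (i + 1) \<omega>))) X = emeasure (P \<bind> past_kernel i) X" .
qed

section \<open>Invariance and the transition operator on square integrable functions\<close>

lemma nn_integral_chain: "u \<in> borel_measurable S \<Longrightarrow> (\<integral>\<^sup>+\<omega>. u (\<xi> i \<omega>) \<partial>P) = (\<integral>\<^sup>+x. u x \<partial>\<pi>)"
  using nn_integral_distr[OF chain_measurable, of u i] by (simp add: marginal measurable_pi)

lemma integral_chain:
  fixes u :: "'a \<Rightarrow> 'b::{banach, second_countable_topology}"
  shows "u \<in> borel_measurable S \<Longrightarrow> (\<integral>\<omega>. u (\<xi> i \<omega>) \<partial>P) = (\<integral>x. u x \<partial>\<pi>)"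
  using integral_distr[OF chain_measurable, of u i] by (simp add: marginal measurable_pi)

text \<open>\<open>\<xi> 0\<close> and \<open>\<xi> 1\<close> have the same law
  \<open>\<pi>\<close>, and by \<open>distr_pair_next\<close> the law of \<open>\<xi> 1\<close> is
  the average of \<open>K (\<xi> 0 \<omega>)\<close>.\<close>

lemma invariance:
  assumes u: "u \<in> borel_measurable S"
  shows "(\<integral>\<^sup>+x. (\<integral>\<^sup>+y. u y \<partial>K x) \<partial>\<pi>) = (\<integral>\<^sup>+x. u x \<partial>\<pi>)"
proof -
  have "(\<integral>\<^sup>+x. (\<integral>\<^sup>+y. u y \<partial>K x) \<partial>\<pi>) = (\<integral>\<^sup>+\<omega>. (\<integral>\<^sup>+y. u y \<partial>K (\<xi> 0 \<omega>)) \<partial>P)"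
    using measurable_compose[OF kernel_subprob nn_integral_measurable_subprob_algebra[OF u]]
    by (rule nn_integral_chain[symmetric])
  also have "\<dots> = (\<integral>\<^sup>+\<omega>. (\<integral>\<^sup>+z. u (snd z) \<partial>past_kernel 0 \<omega>) \<partial>P)"
    unfolding past_kernel_def using u
    by (intro nn_integral_cong) (subst nn_integral_distr[OF Pair_past_measurable], auto)
  also have "\<dots> = (\<integral>\<^sup>+z. u (snd z) \<partial>(P \<bind> past_kernel 0))"
    using u by (subst nn_integral_bind[OF _ past_kernel_measurable]) auto
  also have "\<dots> = (\<integral>\<^sup>+\<omega>. u (\<xi> 1 \<omega>) \<partial>P)"
    unfolding distr_pair_next[symmetric] using u pair_next_measurable[of 0]
    by (subst nn_integral_distr) auto
  finally show ?thesis using nn_integral_chain[OF u] by simp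
qed

lemma transition_op_measurable:
  "g \<in> borel_measurable S \<Longrightarrow> transition_op K g \<in> borel_measurable S"
  unfolding transition_op_def
  by (rule measurable_compose[OF kernel_subprob integral_measurable_subprob_algebra])

text \<open>Cauchy-Schwarz against the constant 1 under the probability measure \<open>K x\<close>.
  Where \<open>g\<close> is not integrable, the default value 0 of the integral makes the bound
  trivial.\<close>

lemma norm_transition_op_sq_le:
  fixes g :: "'a \<Rightarrow> 'b::{banach, second_countable_topology}"
  assumes g: "g \<in> borel_measurable S" and x: "x \<in> space S"
  shows "ennreal ((norm (transition_op K g x))\<^sup>2) \<le> (\<integral>\<^sup>+y. ennreal ((norm (g y))\<^sup>2) \<partial>K x)"
proof (cases "integrable (K x) g")
  case True
  interpret k: prob_space "K x" by (rule prob_space_kernel[OF x])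
  have g': "g \<in> borel_measurable (K x)" using True by auto
  have "ennreal ((norm (transition_op K g x))\<^sup>2) = (ennreal (norm (\<integral>y. g y \<partial>K x)))\<^sup>2"
    by (simp add: transition_op_def ennreal_power)
  also have "\<dots> \<le> (\<integral>\<^sup>+y. ennreal (norm (g y)) * 1 \<partial>K x)\<^sup>2"
    using integral_norm_bound_ennreal[OF True] by (simp add: power_mono)
  also have "\<dots> \<le> (\<integral>\<^sup>+y. (ennreal (norm (g y)))\<^sup>2 \<partial>K x) * (\<integral>\<^sup>+y. 1\<^sup>2 \<partial>K x)"
    using g' by (intro Cauchy_Schwarz_nn_integral) auto
  also have "\<dots> = (\<integral>\<^sup>+y. ennreal ((norm (g y))\<^sup>2) \<partial>K x)"
    by (simp add: k.emeasure_space_1 ennreal_power)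
  finally show ?thesis .
qed (simp add: transition_op_def not_integrable_integral_eq)

lemma square_integrable_pi_iff:
  "square_integrable \<pi> g \<longleftrightarrow> g \<in> borel_measurable S \<and> (\<integral>\<^sup>+x. ennreal ((norm (g x))\<^sup>2) \<partial>\<pi>) < \<infinity>"
  by (auto simp: square_integrable_def integrable_iff_bounded measurable_pi)

text \<open>The operator does not increase the second moment: the pointwise bound is integrated and
  \<open>invariance\<close> removes the kernel.\<close>

lemma square_integrable_transition_op:
  assumes "square_integrable \<pi> g"
  shows "square_integrable \<pi> (transition_op K g)"
proof -
  have g: "g \<in> borel_measurable S" and fin: "(\<integral>\<^sup>+x. ennreal ((norm (g x))\<^sup>2) \<partial>\<pi>) < \<infinity>"
    using assms by (auto simp: square_integrable_pi_iff)
  have "(\<integral>\<^sup>+x. ennreal ((norm (transition_op K g x))\<^sup>2) \<partial>\<pi>)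
      \<le> (\<integral>\<^sup>+x. (\<integral>\<^sup>+y. ennreal ((norm (g y))\<^sup>2) \<partial>K x) \<partial>\<pi>)"
    by (intro nn_integral_mono norm_transition_op_sq_le g) simp
  also have "\<dots> = (\<integral>\<^sup>+x. ennreal ((norm (g x))\<^sup>2) \<partial>\<pi>)"
    using g by (intro invariance) auto
  finally show ?thesis
    using fin transition_op_measurable[OF g] by (auto simp: square_integrable_pi_iff)
qed

lemma square_integrable_transition_op_power:
  "square_integrable \<pi> g \<Longrightarrow> square_integrable \<pi> ((transition_op K ^^ j) g)"
  by (induction j) (auto intro: square_integrable_transition_op)

lemma square_integrable_chain:
  assumes "square_integrable \<pi> g"
  shows "square_integrable P (\<lambda>\<omega>. g (\<xi> i \<omega>))"
proof -
  have g: "g \<in> borel_measurable S" using assms by (simp add: square_integrable_pi_iff)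
  have "(\<integral>\<^sup>+\<omega>. ennreal ((norm (g (\<xi> i \<omega>)))\<^sup>2) \<partial>P) = (\<integral>\<^sup>+x. ennreal ((norm (g x))\<^sup>2) \<partial>\<pi>)"
    using g by (intro nn_integral_chain) auto
  then show ?thesis
    using assms measurable_compose[OF chain_measurable g]
    by (auto simp: square_integrable_pi_iff square_integrable_def integrable_iff_bounded)
qed

text \<open>By invariance the kernel integral of the squared norm has finite expectation, so it is
  almost surely finite. Thus the default value of \<open>transition_op\<close> occurs only on a null
  set.\<close>

lemma AE_integrable_kernel:
  assumes "square_integrable \<pi> g"
  shows "AE \<omega> in P. integrable (K (\<xi> i \<omega>)) g"
proof -
  have g: "g \<in> borel_measurable S" and fin: "(\<integral>\<^sup>+x. ennreal ((norm (g x))\<^sup>2) \<partial>\<pi>) < \<infinity>"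
    using assms by (auto simp: square_integrable_pi_iff)
  define p where "p x = (\<integral>\<^sup>+y. ennreal ((norm (g y))\<^sup>2) \<partial>K x)" for x
  have p: "p \<in> borel_measurable S"
    unfolding p_def using g
    by (intro measurable_compose[OF kernel_subprob nn_integral_measurable_subprob_algebra]) simp
  have "(\<integral>\<^sup>+\<omega>. p (\<xi> i \<omega>) \<partial>P) = (\<integral>\<^sup>+x. ennreal ((norm (g x))\<^sup>2) \<partial>\<pi>)"
    unfolding nn_integral_chain[OF p] unfolding p_def using g by (intro invariance) auto
  then have "AE \<omega> in P. p (\<xi> i \<omega>) \<noteq> \<infinity>"
    using fin measurable_compose[OF chain_measurable p] by (intro nn_integral_PInf_AE) auto
  moreover have "AE \<omega> in P. \<omega> \<in> space P" by simp
  ultimately show ?thesis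
  proof eventually_elim
    case (elim \<omega>)
    interpret k: prob_space "K (\<xi> i \<omega>)" by (intro prob_space_kernel state_space elim)
    have g': "g \<in> borel_measurable (K (\<xi> i \<omega>))"
      using g sets_kernel[OF state_space[OF elim(2)]] by (simp cong: measurable_cong_sets)
    have "integrable (K (\<xi> i \<omega>)) (\<lambda>y. (norm (g y))\<^sup>2)"
      using elim(1) g' by (intro integrableI_nonneg) (auto simp: p_def less_top)
    then have "integrable (K (\<xi> i \<omega>)) (\<lambda>y. norm (g y))"
      by (rule k.square_integrable_imp_integrable[rotated]) (rule measurable_compose[OF g' borel_measurable_norm])
    then show ?case using g' by (rule integrable_norm_cancel)
  qed
qed

section \<open>The Markov property, self-adjointness and conditioning on the future, in weak
  form\<close>

text \<open>The scalar function \<open>inner (h \<omega>) (g y)\<close> is disintegrated along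
  \<open>past_kernel\<close>; the inner product leaves the integral over \<open>y\<close> wherever
  \<open>g\<close> is integrable under \<open>K (\<xi> i \<omega>)\<close>, which holds almost
  surely.\<close>

lemma markov_inner:
  assumes h: "h \<in> borel_measurable (past i)" "square_integrable P h" and g: "square_integrable \<pi> g"
  shows "(\<integral>\<omega>. inner (h \<omega>) (g (\<xi> (i + 1) \<omega>)) \<partial>P) = (\<integral>\<omega>. inner (h \<omega>) (transition_op K g (\<xi> i \<omega>)) \<partial>P)"
proof -
  define u where "u z = inner (h (fst z)) (g (snd z))" for z
  have g_meas: "g \<in> borel_measurable S" using g by (simp add: square_integrable_pi_iff)
  have u: "u \<in> borel_measurable (past i \<Otimes>\<^sub>M S)"
    unfolding u_def
    by (intro borel_measurable_inner measurable_compose[OF measurable_fst h(1)]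
          measurable_compose[OF measurable_snd g_meas])
  have int: "integrable P (\<lambda>\<omega>. u (\<omega>, \<xi> (i + 1) \<omega>))"
    unfolding u_def using square_integrable_inner[OF h(2) square_integrable_chain[OF g]] by simp
  have "integrable (P \<bind> past_kernel i) u"
    unfolding distr_pair_next[symmetric] using int by (subst integrable_distr_eq[OF pair_next_measurable u])
  then have "(\<integral>z. u z \<partial>(P \<bind> past_kernel i)) = (\<integral>\<omega>. (\<integral>z. u z \<partial>past_kernel i \<omega>) \<partial>P)"
    by (rule integral_bind_integrable[OF past_kernel_measurable u])
  also have "(\<integral>z. u z \<partial>(P \<bind> past_kernel i)) = (\<integral>\<omega>. inner (h \<omega>) (g (\<xi> (i + 1) \<omega>)) \<partial>P)"
    unfolding distr_pair_next[symmetric] integral_distr[OF pair_next_measurable u] by (simp add: u_def)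
  also have "(\<integral>\<omega>. (\<integral>z. u z \<partial>past_kernel i \<omega>) \<partial>P) = (\<integral>\<omega>. inner (h \<omega>) (transition_op K g (\<xi> i \<omega>)) \<partial>P)"
  proof (rule integral_cong_AE)
    show "(\<lambda>\<omega>. \<integral>z. u z \<partial>past_kernel i \<omega>) \<in> borel_measurable P"
      by (rule measurable_compose[OF past_kernel_measurable integral_measurable_subprob_algebra[OF u]])
    show "(\<lambda>\<omega>. inner (h \<omega>) (transition_op K g (\<xi> i \<omega>))) \<in> borel_measurable P"
      by (intro borel_measurable_inner square_integrable_measurable[OF h(2)]
            measurable_compose[OF chain_measurable transition_op_measurable[OF g_meas]])
    have "AE \<omega> in P. \<omega> \<in> space P" by simp
    then show "AE \<omega> in P. (\<integral>z. u z \<partial>past_kernel i \<omega>) = inner (h \<omega>) (transition_op K g (\<xi> i \<omega>))"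
      using AE_integrable_kernel[OF g, of i]
    proof eventually_elim
      case (elim \<omega>)
      have "(\<integral>z. u z \<partial>past_kernel i \<omega>) = (\<integral>y. inner (h \<omega>) (g y) \<partial>K (\<xi> i \<omega>))"
        unfolding past_kernel_def integral_distr[OF Pair_past_measurable[OF elim(1)] u] by (simp add: u_def)
      also have "\<dots> = inner (h \<omega>) (transition_op K g (\<xi> i \<omega>))"
        unfolding transition_op_def using elim by simp
      finally show ?case .
    qed
  qed
  finally show ?thesis .
qed

lemma markov_inner_power:
  assumes h: "h \<in> borel_measurable (past i)" "square_integrable P h" and g: "square_integrable \<pi> g"
  shows "(\<integral>\<omega>. inner (h \<omega>) (g (\<xi> (i + int n) \<omega>)) \<partial>P)
    = (\<integral>\<omega>. inner (h \<omega>) ((transition_op K ^^ n) g (\<xi> i \<omega>)) \<partial>P)"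
  using g
proof (induction n arbitrary: g)
  case (Suc n)
  \<comment> \<open>The last transition is removed first, so \<open>h\<close> has to be seen as a
    function of the larger past at time \<open>i + int n\<close>.\<close>
  have h': "h \<in> borel_measurable (past (i + int n))"
    by (rule measurable_from_subalg[OF past_mono h(1)]) simp
  have "(\<integral>\<omega>. inner (h \<omega>) (g (\<xi> (i + int (Suc n)) \<omega>)) \<partial>P)
      = (\<integral>\<omega>. inner (h \<omega>) (transition_op K g (\<xi> (i + int n) \<omega>)) \<partial>P)"
    using markov_inner[OF h' h(2) Suc.prems] by (simp add: ac_simps)
  then show ?case
    using Suc.IH[OF square_integrable_transition_op[OF Suc.prems]] by (simp add: funpow_swap1)
qed simp

lemma chain_past_measurable: "g \<in> borel_measurable S \<Longrightarrow> (\<lambda>\<omega>. g (\<xi> i \<omega>)) \<in> borel_measurable (past i)"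
  by (rule measurable_compose[OF chain_adapted]) simp

lemma integral_inner_chain:
  assumes "square_integrable \<pi> g" "square_integrable \<pi> g'"
  shows "(\<integral>\<omega>. inner (g (\<xi> i \<omega>)) (g' (\<xi> i \<omega>)) \<partial>P) = (\<integral>x. inner (g x) (g' x) \<partial>\<pi>)"
  using assms by (intro integral_chain borel_measurable_inner) (auto simp: square_integrable_pi_iff)

lemma inner_chain_Suc:
  assumes g: "square_integrable \<pi> g" "square_integrable \<pi> g'"
  shows "(\<integral>\<omega>. inner (g (\<xi> i \<omega>)) (g' (\<xi> (i + 1) \<omega>)) \<partial>P) = (\<integral>x. inner (g x) (transition_op K g' x) \<partial>\<pi>)"
proof -
  have "(\<lambda>\<omega>. g (\<xi> i \<omega>)) \<in> borel_measurable (past i)"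
    using g by (intro chain_past_measurable) (simp add: square_integrable_pi_iff)
  from markov_inner[OF this square_integrable_chain[OF g(1)] g(2)]
  show ?thesis using integral_inner_chain[OF g(1) square_integrable_transition_op[OF g(2)]] by simp
qed

text \<open>Reversibility enters here: by \<open>inner_chain_Suc\<close> the two sides are
  expectations over a pair of successive states and over the swapped pair.\<close>

lemma transition_op_selfadjoint:
  assumes g: "square_integrable \<pi> g" "square_integrable \<pi> g'"
  shows "(\<integral>x. inner (transition_op K g x) (g' x) \<partial>\<pi>) = (\<integral>x. inner (g x) (transition_op K g' x) \<partial>\<pi>)"
proof -
  define u where "u z = inner (g (fst z)) (g' (snd z))" for z
  have meas: "g \<in> borel_measurable S" "g' \<in> borel_measurable S"
    using g by (auto simp: square_integrable_pi_iff)
  have u: "u \<in> borel_measurable (S \<Otimes>\<^sub>M S)"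
    unfolding u_def
    by (intro borel_measurable_inner measurable_compose[OF measurable_fst meas(1)]
          measurable_compose[OF measurable_snd meas(2)])
  have pair: "(\<lambda>\<omega>. (\<xi> i \<omega>, \<xi> j \<omega>)) \<in> measurable P (S \<Otimes>\<^sub>M S)" for i j
    by (intro measurable_Pair chain_measurable)
  have "(\<integral>\<omega>. u (\<xi> 0 \<omega>, \<xi> (0 + 1) \<omega>) \<partial>P) = (\<integral>\<omega>. u (\<xi> (0 + 1) \<omega>, \<xi> 0 \<omega>) \<partial>P)"
    using arg_cong[OF reversible[of 0], of "\<lambda>N. \<integral>z. u z \<partial>N"] by (simp only: integral_distr[OF pair u])
  then show ?thesis
    using inner_chain_Suc[OF g, of 0] inner_chain_Suc[OF g(2,1), of 0]
    by (simp add: u_def inner_commute)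
qed

lemma transition_op_power_selfadjoint:
  assumes "square_integrable \<pi> g" "square_integrable \<pi> g'"
  shows "(\<integral>x. inner ((transition_op K ^^ n) g x) (g' x) \<partial>\<pi>) = (\<integral>x. inner (g x) ((transition_op K ^^ n) g' x) \<partial>\<pi>)"
  using assms(2)
proof (induction n arbitrary: g')
  case (Suc n)
  have "(\<integral>x. inner ((transition_op K ^^ Suc n) g x) (g' x) \<partial>\<pi>)
      = (\<integral>x. inner ((transition_op K ^^ n) g x) (transition_op K g' x) \<partial>\<pi>)"
    using transition_op_selfadjoint[OF square_integrable_transition_op_power[OF assms(1)] Suc.prems] by simp
  then show ?case
    using Suc.IH[OF square_integrable_transition_op[OF Suc.prems]] by (simp add: funpow_swap1)
qed simp

text \<open>Conditioning an earlier state on a later one: given \<open>\<xi> (i + int m)\<close>,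
  the expectation of \<open>g'\<close> at time \<open>i\<close> is again the \<open>m\<close>-th
  power applied to \<open>g'\<close>. The Markov property puts the power on \<open>g\<close>, and
  self-adjointness moves it to \<open>g'\<close>.\<close>

lemma inner_chain_power:
  assumes g: "square_integrable \<pi> g" "square_integrable \<pi> g'"
  shows "(\<integral>\<omega>. inner (g (\<xi> (i + int m) \<omega>)) (g' (\<xi> i \<omega>)) \<partial>P)
    = (\<integral>x. inner (g x) ((transition_op K ^^ m) g' x) \<partial>\<pi>)"
proof -
  have "(\<lambda>\<omega>. g' (\<xi> i \<omega>)) \<in> borel_measurable (past i)"
    using g by (intro chain_past_measurable) (simp add: square_integrable_pi_iff)
  from markov_inner_power[OF this square_integrable_chain[OF g(2)] g(1), of m]
  have "(\<integral>\<omega>. inner (g (\<xi> (i + int m) \<omega>)) (g' (\<xi> i \<omega>)) \<partial>P)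
      = (\<integral>x. inner ((transition_op K ^^ m) g x) (g' x) \<partial>\<pi>)"
    using integral_inner_chain[OF g(2) square_integrable_transition_op_power[OF g(1)]]
    by (simp add: inner_commute)
  then show ?thesis using transition_op_power_selfadjoint[OF g] by simp
qed

section \<open>From the martingale back to the powers of the transition operator\<close>

text \<open>
  The hypothesis says that \<open>W k (\<xi> e)\<close> is the conditional expectation of \<open>Z k\<close> given \<open>\<xi> e\<close>.
  Conditional Jensen for the maximum is obtained by testing against \<open>W k\<close> on the set where the
  index \<open>k\<close> attains the maximum.
\<close>

lemma max_conditional_le:
  fixes W :: "nat \<Rightarrow> 'a \<Rightarrow> 'h::{real_inner, banach, second_countable_topology}"
  assumes W: "\<And>k. square_integrable \<pi> (W k)" and Z: "\<And>k. square_integrable P (Z k)"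
    and n: "1 \<le> n"
    and cond: "\<And>k \<phi>. k \<in> {1..n} \<Longrightarrow> square_integrable \<pi> \<phi> \<Longrightarrow>
      (\<integral>\<omega>. inner (\<phi> (\<xi> e \<omega>)) (Z k \<omega>) \<partial>P) = (\<integral>x. inner (\<phi> x) (W k x) \<partial>\<pi>)"
  shows "(\<integral>x. (MAX k\<in>{1..n}. (norm (W k x))\<^sup>2) \<partial>\<pi>) \<le> (\<integral>\<omega>. (MAX k\<in>{1..n}. (norm (Z k \<omega>))\<^sup>2) \<partial>P)"
proof -
  \<comment> \<open>\<open>LEAST\<close> breaks ties, so the sets \<open>A k\<close> are disjoint
    and measurable, and at each point the \<open>F k\<close> single out one maximal
    \<open>W k\<close>.\<close>
  define \<kappa> where "\<kappa> x = (LEAST k. k \<in> {1..n} \<and> (\<forall>j\<in>{1..n}. norm (W j x) \<le> norm (W k x)))" for x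
  define A where "A k = {x \<in> space S. \<kappa> x = k}" for k
  define F where "F k x = indicator (A k) x *\<^sub>R W k x" for k x
  have W_meas[measurable]: "W k \<in> borel_measurable S" for k
    using W by (simp add: square_integrable_pi_iff)
  have A: "A k \<in> sets \<pi>" for k
  proof -
    have "\<kappa> \<in> measurable S (count_space UNIV)"
      unfolding \<kappa>_def by measurable
    then show ?thesis unfolding A_def by simp
  qed
  have F: "square_integrable \<pi> (F k)" for k
    unfolding F_def by (intro square_integrable_indicator A W)
  have \<kappa>: "\<kappa> x \<in> {1..n}" "\<forall>j\<in>{1..n}. norm (W j x) \<le> norm (W (\<kappa> x) x)" for x
  proof -
    have "(MAX k\<in>{1..n}. norm (W k x)) \<in> (\<lambda>k. norm (W k x)) ` {1..n}"
      using n by (intro Max_in) auto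
    then obtain k where "k \<in> {1..n}" "(MAX k\<in>{1..n}. norm (W k x)) = norm (W k x)"
      by blast
    moreover from this have "\<forall>j\<in>{1..n}. norm (W j x) \<le> norm (W k x)"
      by (metis (no_types, lifting) Max_ge finite_atLeastAtMost finite_imageI imageI)
    ultimately have "\<exists>k. k \<in> {1..n} \<and> (\<forall>j\<in>{1..n}. norm (W j x) \<le> norm (W k x))" by blast
    from LeastI_ex[OF this] show "\<kappa> x \<in> {1..n}" "\<forall>j\<in>{1..n}. norm (W j x) \<le> norm (W (\<kappa> x) x)"
      unfolding \<kappa>_def by blast+
  qed
  have Max_W: "(MAX k\<in>{1..n}. (norm (W k x))\<^sup>2) = (norm (W (\<kappa> x) x))\<^sup>2" for x
    using \<kappa>[of x] by (intro Max_eqI) (auto intro: power_mono)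
  have pick: "(\<Sum>k=1..n. inner (F k x) (v k)) = inner (W (\<kappa> x) x) (v (\<kappa> x))" if "x \<in> space S" for x v
  proof -
    have "(\<Sum>k=1..n. inner (F k x) (v k)) = (\<Sum>k=1..n. if k = \<kappa> x then inner (W k x) (v k) else 0)"
      using that by (intro sum.cong) (auto simp: F_def A_def indicator_def)
    then show ?thesis using \<kappa>(1)[of x] by simp
  qed
  let ?L = "\<integral>x. (MAX k\<in>{1..n}. (norm (W k x))\<^sup>2) \<partial>\<pi>"
  let ?R = "\<integral>\<omega>. (MAX k\<in>{1..n}. (norm (Z k \<omega>))\<^sup>2) \<partial>P"
  have int_Z: "integrable P (\<lambda>\<omega>. MAX k\<in>{1..n}. (norm (Z k \<omega>))\<^sup>2)"
    using n Z by (intro integrable_Max) (auto simp: square_integrable_def)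
  have int_W: "integrable P (\<lambda>\<omega>. MAX k\<in>{1..n}. (norm (W k (\<xi> e \<omega>)))\<^sup>2)"
    using n square_integrable_chain[OF W] by (intro integrable_Max) (auto simp: square_integrable_def)
  have L: "(\<integral>\<omega>. (MAX k\<in>{1..n}. (norm (W k (\<xi> e \<omega>)))\<^sup>2) \<partial>P) = ?L"
    by (rule integral_chain) simp
  have "?L = (\<integral>x. (\<Sum>k=1..n. inner (F k x) (W k x)) \<partial>\<pi>)"
    unfolding Max_W unfolding power2_norm_eq_inner
    by (intro Bochner_Integration.integral_cong refl pick[symmetric]) simp
  also have "\<dots> = (\<Sum>k=1..n. \<integral>x. inner (F k x) (W k x) \<partial>\<pi>)"
    by (intro Bochner_Integration.integral_sum square_integrable_inner F W)
  also have "\<dots> = (\<Sum>k=1..n. \<integral>\<omega>. inner (F k (\<xi> e \<omega>)) (Z k \<omega>) \<partial>P)"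
    using cond[OF _ F] by simp
  also have "\<dots> = (\<integral>\<omega>. (\<Sum>k=1..n. inner (F k (\<xi> e \<omega>)) (Z k \<omega>)) \<partial>P)"
    by (intro Bochner_Integration.integral_sum[symmetric] square_integrable_inner square_integrable_chain F Z)
  \<comment> \<open>Bounding the inner product by half the sum of squares gives
    \<open>?L \<le> (?L + ?R) / 2\<close>, and half of \<open>?L\<close> is absorbed on the
    left.\<close>
  also have "\<dots> \<le> (\<integral>\<omega>. ((MAX k\<in>{1..n}. (norm (W k (\<xi> e \<omega>)))\<^sup>2) + (MAX k\<in>{1..n}. (norm (Z k \<omega>))\<^sup>2)) / 2 \<partial>P)"
  proof (rule integral_mono)
    show "integrable P (\<lambda>\<omega>. \<Sum>k=1..n. inner (F k (\<xi> e \<omega>)) (Z k \<omega>))"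
      by (intro Bochner_Integration.integrable_sum square_integrable_inner square_integrable_chain F Z)
    show "integrable P (\<lambda>\<omega>. ((MAX k\<in>{1..n}. (norm (W k (\<xi> e \<omega>)))\<^sup>2) + (MAX k\<in>{1..n}. (norm (Z k \<omega>))\<^sup>2)) / 2)"
      using int_W int_Z by simp
    fix \<omega> assume "\<omega> \<in> space P"
    then have "(\<Sum>k=1..n. inner (F k (\<xi> e \<omega>)) (Z k \<omega>)) = inner (W (\<kappa> (\<xi> e \<omega>)) (\<xi> e \<omega>)) (Z (\<kappa> (\<xi> e \<omega>)) \<omega>)"
      by (intro pick state_space)
    also have "\<dots> \<le> ((norm (W (\<kappa> (\<xi> e \<omega>)) (\<xi> e \<omega>)))\<^sup>2 + (norm (Z (\<kappa> (\<xi> e \<omega>)) \<omega>))\<^sup>2) / 2"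
      by (rule order_trans[OF abs_ge_self abs_inner_le_sq])
    also have "(norm (Z (\<kappa> (\<xi> e \<omega>)) \<omega>))\<^sup>2 \<le> (MAX k\<in>{1..n}. (norm (Z k \<omega>))\<^sup>2)"
      using \<kappa>(1) by (intro Max_ge) auto
    finally show "(\<Sum>k=1..n. inner (F k (\<xi> e \<omega>)) (Z k \<omega>))
      \<le> ((MAX k\<in>{1..n}. (norm (W k (\<xi> e \<omega>)))\<^sup>2) + (MAX k\<in>{1..n}. (norm (Z k \<omega>))\<^sup>2)) / 2"
      unfolding Max_W by simp
  qed
  also have "\<dots> = (?L + ?R) / 2"
    unfolding L[symmetric] using int_W int_Z by simp
  finally show ?thesis by simp
qed

text \<open>The index \<open>j\<close> runs forward in time, with \<open>i = n - j\<close>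
  applications of the operator at time \<open>1 - i\<close>. The step from \<open>i = m + 1\<close>
  to \<open>i = m\<close> is the Markov property at time \<open>- int m\<close>.\<close>

lemma reversed_martingale:
  fixes f :: "'a \<Rightarrow> 'h::{real_inner, banach, second_countable_topology}"
  assumes f: "square_integrable \<pi> f"
  shows "L2_martingale P (\<lambda>j. past (1 - int (n - j)))
    (\<lambda>j \<omega>. (transition_op K ^^ (n - j)) f (\<xi> (1 - int (n - j)) \<omega>))"
proof
  fix i j :: nat
  show "subalgebra P (past (1 - int (n - j)))" by (rule subalgebra_past)
  show "i \<le> j \<Longrightarrow> subalgebra (past (1 - int (n - j))) (past (1 - int (n - i)))"
    by (intro past_mono) simp
  show "(\<lambda>\<omega>. (transition_op K ^^ (n - j)) f (\<xi> (1 - int (n - j)) \<omega>)) \<in> borel_measurable (past (1 - int (n - j)))"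
    using square_integrable_transition_op_power[OF f]
    by (intro chain_past_measurable) (simp add: square_integrable_pi_iff)
  show "square_integrable P (\<lambda>\<omega>. (transition_op K ^^ (n - j)) f (\<xi> (1 - int (n - j)) \<omega>))"
    by (intro square_integrable_chain square_integrable_transition_op_power f)
  fix h :: "'w \<Rightarrow> 'h"
  assume h: "h \<in> borel_measurable (past (1 - int (n - j)))" "square_integrable P h"
  show "(\<integral>\<omega>. inner (h \<omega>) ((transition_op K ^^ (n - Suc j)) f (\<xi> (1 - int (n - Suc j)) \<omega>)
      - (transition_op K ^^ (n - j)) f (\<xi> (1 - int (n - j)) \<omega>)) \<partial>P) = 0"
  \<comment> \<open>For \<open>j \<ge> n\<close> truncated subtraction makes both indices 0, so the
    process is constant from \<open>n\<close> on.\<close>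
  proof (cases "j < n")
    case True
    define m where "m = n - Suc j"
    have m: "n - j = Suc m" "n - Suc j = m" using True by (auto simp: m_def)
    have "h \<in> borel_measurable (past (- int m))" using h(1) by (simp add: m)
    from markov_inner[OF this h(2) square_integrable_transition_op_power[OF f, of m]]
    show ?thesis
      using integral_inner_diff[OF h(2) square_integrable_chain[OF square_integrable_transition_op_power[OF f]]
          square_integrable_chain[OF square_integrable_transition_op_power[OF f]],
          of m "1 - int m" "Suc m" "- int m"]
      by (simp add: m)
  qed simp
qed

text \<open>From time \<open>1 - i\<close> to time \<open>e\<close> there are
  \<open>i + e - 1\<close> transitions, so conditioning the \<open>i\<close>-th martingale variable
  on \<open>\<xi> e\<close> raises the power from \<open>i\<close> to \<open>2 * i - 1 + e\<close>.
  Odd powers come from \<open>e = 0\<close>, even powers from \<open>e = 1\<close>.\<close>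

lemma maximal_inequality_parity:
  fixes f :: "'a \<Rightarrow> 'h::{real_inner, banach, second_countable_topology}" and c :: "nat \<Rightarrow> real"
  assumes f: "square_integrable \<pi> f" and n: "1 \<le> n"
  shows "(\<integral>x. (MAX k\<in>{1..n}. (norm (\<Sum>i=1..k. c i *\<^sub>R (transition_op K ^^ (2 * i - 1 + e)) f x))\<^sup>2) \<partial>\<pi>)
    \<le> 36 * (\<Sum>j=1..n. b_coeff (\<lambda>k. \<Sum>i=1..k. c i) j * (\<integral>x. (norm ((transition_op K ^^ j) f x))\<^sup>2 \<partial>\<pi>))"
proof -
  let ?X = "\<lambda>j \<omega>. (transition_op K ^^ (n - j)) f (\<xi> (1 - int (n - j)) \<omega>)"
  interpret X: L2_martingale P "\<lambda>j. past (1 - int (n - j))" ?X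
    by (rule reversed_martingale[OF f])
  have "(\<integral>x. (MAX k\<in>{1..n}. (norm (\<Sum>i=1..k. c i *\<^sub>R (transition_op K ^^ (2 * i - 1 + e)) f x))\<^sup>2) \<partial>\<pi>)
      \<le> (\<integral>\<omega>. (MAX k\<in>{1..n}. (norm (\<Sum>i=1..k. c i *\<^sub>R ?X (n - i) \<omega>))\<^sup>2) \<partial>P)"
  proof (rule max_conditional_le[where e = "int e"])
    fix k and \<phi> :: "'a \<Rightarrow> 'h" assume k: "k \<in> {1..n}" and \<phi>: "square_integrable \<pi> \<phi>"
    have "(\<integral>\<omega>. inner (\<phi> (\<xi> (int e) \<omega>)) (?X (n - i) \<omega>) \<partial>P)
        = (\<integral>x. inner (\<phi> x) ((transition_op K ^^ (2 * i - 1 + e)) f x) \<partial>\<pi>)" if "i \<in> {1..k}" for i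
    proof -
      \<comment> \<open>\<open>i \<ge> 1\<close> and \<open>i \<le> n\<close> keep the natural
        subtractions from truncating.\<close>
      have i: "n - (n - i) = i" "1 - int i + int (i + e - 1) = int e" "(i + e - 1) + i = 2 * i - 1 + e"
        using that k by auto
      have "(transition_op K ^^ (2 * i - 1 + e)) f = (transition_op K ^^ (i + e - 1)) ((transition_op K ^^ i) f)"
        unfolding i(3)[symmetric] funpow_add by simp
      then show ?thesis
        using inner_chain_power[OF \<phi> square_integrable_transition_op_power[OF f], of "1 - int i" "i + e - 1" i]
        unfolding i by simp
    qed
    then show "(\<integral>\<omega>. inner (\<phi> (\<xi> (int e) \<omega>)) (\<Sum>i=1..k. c i *\<^sub>R ?X (n - i) \<omega>) \<partial>P)
      = (\<integral>x. inner (\<phi> x) (\<Sum>i=1..k. c i *\<^sub>R (transition_op K ^^ (2 * i - 1 + e)) f x) \<partial>\<pi>)"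
      by (simp only: integral_inner_sum[OF square_integrable_chain[OF \<phi>] X.sq_int]
            integral_inner_sum[OF \<phi> square_integrable_transition_op_power[OF f]] cong: sum.cong)
  qed (intro n square_integrable_sum square_integrable_scaleR square_integrable_transition_op_power f X.sq_int)+
  also have "\<dots> \<le> 36 * (\<Sum>j=1..n. b_coeff (\<lambda>k. \<Sum>i=1..k. c i) j * (\<integral>\<omega>. (norm (?X (n - j) \<omega>))\<^sup>2 \<partial>P))"
    by (rule X.max_weighted_sum[OF n])
  also have "(\<Sum>j=1..n. b_coeff (\<lambda>k. \<Sum>i=1..k. c i) j * (\<integral>\<omega>. (norm (?X (n - j) \<omega>))\<^sup>2 \<partial>P))
      = (\<Sum>j=1..n. b_coeff (\<lambda>k. \<Sum>i=1..k. c i) j * (\<integral>x. (norm ((transition_op K ^^ j) f x))\<^sup>2 \<partial>\<pi>))"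
  proof (intro sum.cong refl arg_cong2[where f = "(*)"])
    fix j assume "j \<in> {1..n}"
    then have j: "n - (n - j) = j" by auto
    have "(transition_op K ^^ j) f \<in> borel_measurable S"
      using square_integrable_transition_op_power[OF f] by (simp add: square_integrable_pi_iff)
    then show "(\<integral>\<omega>. (norm (?X (n - j) \<omega>))\<^sup>2 \<partial>P) = (\<integral>x. (norm ((transition_op K ^^ j) f x))\<^sup>2 \<partial>\<pi>)"
      unfolding j by (intro integral_chain) simp
  qed
  finally show ?thesis .
qed

text \<open>Each partial sum is an even plus an odd partial sum of length at most \<open>n\<close>.
  The squared norm of a sum costs a factor 2 for each parity, whence
  \<open>144 = 2 * 36 + 2 * 36\<close>.\<close>

lemma maximal_inequality:
  fixes f :: "'a \<Rightarrow> 'h::{real_inner, banach, second_countable_topology}" and a :: "nat \<Rightarrow> real"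
  assumes f: "square_integrable \<pi> f" and n: "1 \<le> n"
  shows "(\<integral>x. (MAX k\<in>{1..2 * n}. (norm (\<Sum>j=1..k. a j *\<^sub>R (transition_op K ^^ j) f x))\<^sup>2) \<partial>\<pi>)
    \<le> 144 * (\<Sum>j=1..n. b_star a j * (\<integral>x. (norm ((transition_op K ^^ j) f x))\<^sup>2 \<partial>\<pi>))"
proof -
  define W where "W c e k x = (\<Sum>i=1..k. c i *\<^sub>R (transition_op K ^^ (2 * i - 1 + e)) f x)"
    for c :: "nat \<Rightarrow> real" and e k x
  define E where "E x = (MAX k\<in>{1..n}. (norm (W (\<lambda>i. a (2 * i)) 1 k x))\<^sup>2)" for x
  define D where "D x = (MAX k\<in>{1..n}. (norm (W (\<lambda>i. a (2 * i - 1)) 0 k x))\<^sup>2)" for x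
  define p where "p j = (\<integral>x. (norm ((transition_op K ^^ j) f x))\<^sup>2 \<partial>\<pi>)" for j
  have p0: "0 \<le> p j" for j by (simp add: p_def)
  have W_sq: "square_integrable \<pi> (W c e k)" for c e k
    unfolding W_def by (intro square_integrable_sum square_integrable_scaleR square_integrable_transition_op_power f)
  have int: "integrable \<pi> E" "integrable \<pi> D"
    unfolding E_def D_def using n W_sq by (auto intro!: integrable_Max simp: square_integrable_def)
  \<comment> \<open>Length 0 has to be covered: for \<open>k = 1\<close> the even part of the sum is
    empty.\<close>
  have W_le: "(norm (W c e k x))\<^sup>2 \<le> (MAX k\<in>{1..n}. (norm (W c e k x))\<^sup>2)" if "k \<le> n" for c e k x
  proof (cases "k = 0")
    case True
    have "0 \<le> (MAX k\<in>{1..n}. (norm (W c e k x))\<^sup>2)" using n by (intro Max_image_nonneg) auto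
    then show ?thesis using True by (simp add: W_def)
  next
    case False
    then show ?thesis using that by (intro Max_ge) auto
  qed
  have bound: "(MAX k\<in>{1..2 * n}. (norm (\<Sum>j=1..k. a j *\<^sub>R (transition_op K ^^ j) f x))\<^sup>2) \<le> 2 * E x + 2 * D x" for x
  proof (rule Max.boundedI)
    fix z assume "z \<in> (\<lambda>k. (norm (\<Sum>j=1..k. a j *\<^sub>R (transition_op K ^^ j) f x))\<^sup>2) ` {1..2 * n}"
    then obtain k where k: "k \<le> 2 * n" and z: "z = (norm (\<Sum>j=1..k. a j *\<^sub>R (transition_op K ^^ j) f x))\<^sup>2"
      by auto
    have "(\<Sum>j=1..k. a j *\<^sub>R (transition_op K ^^ j) f x)
        = W (\<lambda>i. a (2 * i)) 1 (k div 2) x + W (\<lambda>i. a (2 * i - 1)) 0 ((k + 1) div 2) x"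
      unfolding sum_even_odd_split[of _ k] W_def by (intro arg_cong2[where f = "(+)"] sum.cong) auto
    then have "z \<le> 2 * (norm (W (\<lambda>i. a (2 * i)) 1 (k div 2) x))\<^sup>2 + 2 * (norm (W (\<lambda>i. a (2 * i - 1)) 0 ((k + 1) div 2) x))\<^sup>2"
      unfolding z by (simp only: norm_add_sq_le)
    moreover have "k div 2 \<le> n" "(k + 1) div 2 \<le> n" using k by auto
    ultimately show "z \<le> 2 * E x + 2 * D x"
      unfolding E_def D_def
      using W_le[of "k div 2" "\<lambda>i. a (2 * i)" 1 x] W_le[of "(k + 1) div 2" "\<lambda>i. a (2 * i - 1)" 0 x]
      by linarith
  qed (use n in auto)
  have "(\<integral>x. (MAX k\<in>{1..2 * n}. (norm (\<Sum>j=1..k. a j *\<^sub>R (transition_op K ^^ j) f x))\<^sup>2) \<partial>\<pi>)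
      \<le> (\<integral>x. 2 * E x + 2 * D x \<partial>\<pi>)"
  proof (rule integral_mono[OF _ _ bound])
    have "square_integrable \<pi> (\<lambda>x. \<Sum>j=1..k. a j *\<^sub>R (transition_op K ^^ j) f x)" for k
      by (intro square_integrable_sum square_integrable_scaleR square_integrable_transition_op_power f)
    then show "integrable \<pi> (\<lambda>x. MAX k\<in>{1..2 * n}. (norm (\<Sum>j=1..k. a j *\<^sub>R (transition_op K ^^ j) f x))\<^sup>2)"
      using n by (intro integrable_Max) (auto simp: square_integrable_def)
    show "integrable \<pi> (\<lambda>x. 2 * E x + 2 * D x)" using int by simp
  qed
  also have "\<dots> = 2 * (\<integral>x. E x \<partial>\<pi>) + 2 * (\<integral>x. D x \<partial>\<pi>)"
    using int by simp
  also have "\<dots> \<le> 2 * (36 * (\<Sum>j=1..n. b_coeff (s_even a) j * p j)) + 2 * (36 * (\<Sum>j=1..n. b_coeff (s_odd a) j * p j))"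
    unfolding E_def D_def W_def p_def s_even_def[abs_def] s_odd_def[abs_def]
    by (intro add_mono mult_left_mono maximal_inequality_parity f n) auto
  also have "\<dots> \<le> 2 * (36 * (\<Sum>j=1..n. b_star a j * p j)) + 2 * (36 * (\<Sum>j=1..n. b_star a j * p j))"
    by (intro add_mono mult_left_mono sum_mono mult_right_mono p0) (auto simp: b_star_def)
  finally show ?thesis by (simp add: p_def)
qed

end

section \<open>The inequality for extended nonnegative integrals\<close>

theorem theorem10:
  "\<exists>C::real. 0 \<le> C \<and> C \<le> absolute_bound \<and>
    (\<forall>(P::'w measure) (S::'a measure) (K::'a \<Rightarrow> 'a measure) (\<pi>::'a measure)
       (\<xi>::int \<Rightarrow> 'w \<Rightarrow> 'a)
       (f::'a \<Rightarrow> 'h::{real_inner, banach, second_countable_topology})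
       (a::nat \<Rightarrow> real) (n::nat).
      stationary_reversible_markov_chain P S K \<pi> \<xi> \<longrightarrow>
      f \<in> borel_measurable S \<longrightarrow>
      (\<integral>\<^sup>+x. ennreal ((norm (f x))\<^sup>2) \<partial>\<pi>) < \<infinity> \<longrightarrow>
      1 \<le> n \<longrightarrow>
      (\<integral>\<^sup>+x. ennreal (MAX k\<in>{1..2 * n}.
                (norm (\<Sum>j=1..k. a j *\<^sub>R (transition_op K ^^ j) f x))\<^sup>2) \<partial>\<pi>)
        \<le> ennreal C * (\<Sum>j=1..n. ennreal (b_star a j) *
              (\<integral>\<^sup>+x. ennreal ((norm ((transition_op K ^^ j) f x))\<^sup>2) \<partial>\<pi>)))"
\<comment> \<open>The witness is the constant of \<open>maximal_inequality\<close>; all functions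
  involved are integrable, so what remains is the passage between real and extended nonnegative
  integrals.\<close>
proof (intro exI[of _ 144] conjI allI impI)
  show "144 \<le> absolute_bound" by (simp add: absolute_bound_def)
  fix P :: "'w measure" and S :: "'a measure" and K \<pi> \<xi> and f :: "'a \<Rightarrow> 'h" and a :: "nat \<Rightarrow> real" and n :: nat
  assume chain: "stationary_reversible_markov_chain P S K \<pi> \<xi>"
    and f: "f \<in> borel_measurable S" "(\<integral>\<^sup>+x. ennreal ((norm (f x))\<^sup>2) \<partial>\<pi>) < \<infinity>" and n: "1 \<le> n"
  interpret stationary_reversible_markov_chain P S K \<pi> \<xi> by (rule chain)
  have f_sq: "square_integrable \<pi> f" using f by (simp add: square_integrable_pi_iff)
  let ?p = "\<lambda>j. \<integral>x. (norm ((transition_op K ^^ j) f x))\<^sup>2 \<partial>\<pi>"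
  let ?W = "\<lambda>x k. (norm (\<Sum>j=1..k. a j *\<^sub>R (transition_op K ^^ j) f x))\<^sup>2"
  have sq: "square_integrable \<pi> (\<lambda>x. \<Sum>j=1..k. a j *\<^sub>R (transition_op K ^^ j) f x)" for k
    by (intro square_integrable_sum square_integrable_scaleR square_integrable_transition_op_power f_sq)
  have "integrable \<pi> (\<lambda>x. MAX k\<in>{1..2 * n}. ?W x k)"
    using n sq by (intro integrable_Max) (auto simp: square_integrable_def)
  moreover have "0 \<le> (MAX k\<in>{1..2 * n}. ?W x k)" for x
    using n by (intro Max_image_nonneg) auto
  ultimately have "(\<integral>\<^sup>+x. ennreal (MAX k\<in>{1..2 * n}. ?W x k) \<partial>\<pi>) = ennreal (\<integral>x. (MAX k\<in>{1..2 * n}. ?W x k) \<partial>\<pi>)"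
    by (intro nn_integral_eq_integral) simp_all
  also have "\<dots> \<le> ennreal (144 * (\<Sum>j=1..n. b_star a j * ?p j))"
    by (intro ennreal_leI maximal_inequality f_sq n)
  \<comment> \<open>\<open>ennreal\<close> respects sums and products of nonnegative reals;
    \<open>b_star_nonneg\<close> provides the sign of the coefficients.\<close>
  also have "\<dots> = ennreal 144 * (\<Sum>j=1..n. ennreal (b_star a j) * ennreal (?p j))"
    by (simp add: ennreal_mult sum_nonneg b_star_nonneg flip: sum_ennreal)
  also have "(\<Sum>j=1..n. ennreal (b_star a j) * ennreal (?p j))
      = (\<Sum>j=1..n. ennreal (b_star a j) * (\<integral>\<^sup>+x. ennreal ((norm ((transition_op K ^^ j) f x))\<^sup>2) \<partial>\<pi>))"
    using square_integrable_transition_op_power[OF f_sq]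
    by (intro sum.cong) (auto simp: nn_integral_eq_integral square_integrable_def)
  finally show "(\<integral>\<^sup>+x. ennreal (MAX k\<in>{1..2 * n}. ?W x k) \<partial>\<pi>)
    \<le> ennreal 144 * (\<Sum>j=1..n. ennreal (b_star a j) *
        (\<integral>\<^sup>+x. ennreal ((norm ((transition_op K ^^ j) f x))\<^sup>2) \<partial>\<pi>))" .
qed simp

end
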